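(* Let $a,b\in\mathbb{C}$ with $a\ne b$, let $f=(t-a)(t-b)\in\mathbb{C}[t]$, and let $I=\langle f\rangle$ be the ideal of $\mathbb{C}[t]$ generated by $f$. Then $\operatorname{H}^2(\mathfrak{sl}_2\otimes I,\mathbb{C})$ is isomorphic as an $\mathfrak{sl}_2\times\mathfrak{sl}_2$-module to $$[\mathbb{C}\boxtimes\mathbb{C}]\oplus[V(2)\boxtimes V(2)]\oplus[V(4)\boxtimes\mathbb{C}]\oplus[\mathbb{C}\boxtimes V(4)].$$
   Context: $\mathfrak{sl}_2=\mathfrak{sl}_2(\mathbb{C})$; $V(m)$ is its irreducible module of highest weight $m$ (dimension $m+1$); $\boxtimes$ is the external tensor product, giving an $\mathfrak{sl}_2\times\mathfrak{sl}_2$-module. $\mathfrak{sl}_2[t]=\mathfrak{sl}_2\otimes_{\mathbb{C}}\mathbb{C}[t]$ has bracket $[x\otimes p,y\otimes q]=[x,y]\otimes pq$, and $\mathfrak{sl}_2\otimes I$ is an ideal of it. The adjoint action of $\mathfrak{sl}_2[t]$ on $\mathfrak{sl}_2\otimes I$ induces an action on the Lie algebra cohomology $\operatorname{H}^2(\mathfrak{sl}_2\otimes I,\mathbb{C})$ that factors through $\mathfrak{sl}_2[t]/(\mathfrak{sl}_2\otimes I)$, which is identified with $\mathfrak{sl}_2\times\mathfrak{sl}_2$ via $x\otimes p\mapsto(p(a)x,p(b)x)$. *)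

theory Defs
  imports "HOL-Analysis.Analysis" "HOL-Computational_Algebra.Polynomial"
begin

section \<open>Modules over complex Lie algebras\<close>

record ('g, 'v) lie_mod =
  mcarrier :: "'v set"
  madd :: "'v \<Rightarrow> 'v \<Rightarrow> 'v"
  mscale :: "complex \<Rightarrow> 'v \<Rightarrow> 'v"
  mact :: "'g \<Rightarrow> 'v \<Rightarrow> 'v"

definition submodule :: "'g set \<Rightarrow> ('g, 'v) lie_mod \<Rightarrow> 'v set \<Rightarrow> bool" where
  "submodule G M W \<longleftrightarrow> W \<subseteq> mcarrier M \<and> W \<noteq> {} \<and>
     (\<forall>u\<in>W. \<forall>v\<in>W. madd M u v \<in> W) \<and>
     (\<forall>c. \<forall>u\<in>W. mscale M c u \<in> W) \<and>
     (\<forall>x\<in>G. \<forall>u\<in>W. mact M x u \<in> W)"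

text \<open>
  A Lie algebra structure on a whole type. The Lie algebras that occur below are
  subspaces of such a type closed under the bracket; \<open>G\<close> and \<open>L\<close> range over them.
\<close>

locale complex_lie_algebra = vector_space scale
  for scale :: "complex \<Rightarrow> 'a::ab_group_add \<Rightarrow> 'a" +
  fixes bracket :: "'a \<Rightarrow> 'a \<Rightarrow> 'a"
  assumes bracket_add_left: "bracket (x + y) z = bracket x z + bracket y z"
    and bracket_add_right: "bracket x (y + z) = bracket x y + bracket x z"
    and bracket_scale_left: "bracket (scale c x) y = scale c (bracket x y)"
    and bracket_scale_right: "bracket x (scale c y) = scale c (bracket x y)"
    and bracket_self: "bracket x x = 0"
    and jacobi: "bracket x (bracket y z) + bracket y (bracket z x) + bracket z (bracket x y) = 0"
begin

text \<open>
  The first six clauses say that the carrier is a complex vector space; negatives are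
  supplied by scaling with \<open>- 1\<close>.
\<close>

definition lie_module :: "'a set \<Rightarrow> ('a, 'v) lie_mod \<Rightarrow> bool" where
  "lie_module G M \<longleftrightarrow> submodule G M (mcarrier M) \<and>
     (\<forall>u\<in>mcarrier M. \<forall>v\<in>mcarrier M. \<forall>w\<in>mcarrier M. madd M (madd M u v) w = madd M u (madd M v w)) \<and>
     (\<forall>u\<in>mcarrier M. \<forall>v\<in>mcarrier M. madd M u v = madd M v u) \<and>
     (\<forall>u\<in>mcarrier M. \<forall>v\<in>mcarrier M. madd M (mscale M 0 u) v = v) \<and>
     (\<forall>c d. \<forall>u\<in>mcarrier M. mscale M (c + d) u = madd M (mscale M c u) (mscale M d u) \<and>
        mscale M (c * d) u = mscale M c (mscale M d u) \<and> mscale M 1 u = u) \<and>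
     (\<forall>c. \<forall>u\<in>mcarrier M. \<forall>v\<in>mcarrier M. mscale M c (madd M u v) = madd M (mscale M c u) (mscale M c v)) \<and>
     (\<forall>x\<in>G. \<forall>u\<in>mcarrier M. \<forall>v\<in>mcarrier M. mact M x (madd M u v) = madd M (mact M x u) (mact M x v)) \<and>
     (\<forall>x\<in>G. \<forall>c. \<forall>u\<in>mcarrier M. mact M x (mscale M c u) = mscale M c (mact M x u)) \<and>
     (\<forall>x\<in>G. \<forall>y\<in>G. \<forall>u\<in>mcarrier M. mact M (x + y) u = madd M (mact M x u) (mact M y u)) \<and>
     (\<forall>x\<in>G. \<forall>c. \<forall>u\<in>mcarrier M. mact M (scale c x) u = mscale M c (mact M x u)) \<and>
     (\<forall>x\<in>G. \<forall>y\<in>G. \<forall>u\<in>mcarrier M.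
        madd M (mact M (bracket x y) u) (mact M y (mact M x u)) = mact M x (mact M y u))"

definition irreducible_module :: "'a set \<Rightarrow> ('a, 'v) lie_mod \<Rightarrow> bool" where
  "irreducible_module G M \<longleftrightarrow> lie_module G M \<and> \<not> is_singleton (mcarrier M) \<and>
     (\<forall>W. submodule G M W \<longrightarrow> is_singleton W \<or> W = mcarrier M)"

definition isomorphic_modules ::
    "'a set \<Rightarrow> ('a, 'v) lie_mod \<Rightarrow> ('a, 'w) lie_mod \<Rightarrow> bool" where
  "isomorphic_modules G M N \<longleftrightarrow> lie_module G M \<and> lie_module G N \<and>
     (\<exists>\<phi>. bij_betw \<phi> (mcarrier M) (mcarrier N) \<and>
        (\<forall>u\<in>mcarrier M. \<forall>v\<in>mcarrier M. \<phi> (madd M u v) = madd N (\<phi> u) (\<phi> v)) \<and>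
        (\<forall>c. \<forall>u\<in>mcarrier M. \<phi> (mscale M c u) = mscale N c (\<phi> u)) \<and>
        (\<forall>x\<in>G. \<forall>u\<in>mcarrier M. \<phi> (mact M x u) = mact N x (\<phi> u)))"

lemma bracket_skew: "bracket y x = - bracket x y"
proof -
  have "bracket (x + y) (x + y) = bracket x y + bracket y x"
    by (simp add: bracket_add_left bracket_add_right bracket_self[of x] bracket_self[of y])
  then show ?thesis
    by (metis add.commute bracket_self eq_neg_iff_add_eq_0)
qed


subsection \<open>Second cohomology with trivial coefficients\<close>

text \<open>
  Cochains are alternating multilinear forms on \<open>L\<close>, extended by zero to the whole type
  so that equality of cochains is equality of functions.
\<close>

definition cochains1 :: "'a set \<Rightarrow> ('a \<Rightarrow> complex) set" where
  "cochains1 L = {\<eta>. (\<forall>x\<in>L. \<forall>y\<in>L. \<eta> (x + y) = \<eta> x + \<eta> y) \<and>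
     (\<forall>c. \<forall>x\<in>L. \<eta> (scale c x) = c * \<eta> x) \<and>
     (\<forall>x. x \<notin> L \<longrightarrow> \<eta> x = 0)}"

definition cochains2 :: "'a set \<Rightarrow> ('a \<Rightarrow> 'a \<Rightarrow> complex) set" where
  "cochains2 L = {\<omega>. (\<forall>x\<in>L. \<forall>y\<in>L. \<forall>z\<in>L. \<omega> (x + y) z = \<omega> x z + \<omega> y z \<and> \<omega> z (x + y) = \<omega> z x + \<omega> z y) \<and>
     (\<forall>c. \<forall>x\<in>L. \<forall>y\<in>L. \<omega> (scale c x) y = c * \<omega> x y \<and> \<omega> x (scale c y) = c * \<omega> x y) \<and>
     (\<forall>x\<in>L. \<omega> x x = 0) \<and>
     (\<forall>x y. x \<notin> L \<or> y \<notin> L \<longrightarrow> \<omega> x y = 0)}"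

definition diff1 :: "'a set \<Rightarrow> ('a \<Rightarrow> complex) \<Rightarrow> 'a \<Rightarrow> 'a \<Rightarrow> complex" where
  "diff1 L \<eta> = (\<lambda>x y. if x \<in> L \<and> y \<in> L then - \<eta> (bracket x y) else 0)"

definition diff2 :: "'a set \<Rightarrow> ('a \<Rightarrow> 'a \<Rightarrow> complex) \<Rightarrow> 'a \<Rightarrow> 'a \<Rightarrow> 'a \<Rightarrow> complex" where
  "diff2 L \<omega> = (\<lambda>x y z. if x \<in> L \<and> y \<in> L \<and> z \<in> L
     then - \<omega> (bracket x y) z + \<omega> (bracket x z) y - \<omega> (bracket y z) x else 0)"

definition cocycles2 :: "'a set \<Rightarrow> ('a \<Rightarrow> 'a \<Rightarrow> complex) set" where
  "cocycles2 L = {\<omega> \<in> cochains2 L. diff2 L \<omega> = (\<lambda>x y z. 0)}"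

definition coboundaries2 :: "'a set \<Rightarrow> ('a \<Rightarrow> 'a \<Rightarrow> complex) set" where
  "coboundaries2 L = diff1 L ` cochains1 L"

definition cohomologous :: "'a set \<Rightarrow> (('a \<Rightarrow> 'a \<Rightarrow> complex) \<times> ('a \<Rightarrow> 'a \<Rightarrow> complex)) set" where
  "cohomologous L = {(\<omega>, \<omega>'). \<omega> \<in> cocycles2 L \<and> \<omega>' \<in> cocycles2 L \<and>
     (\<lambda>x y. \<omega> x y - \<omega>' x y) \<in> coboundaries2 L}"

text \<open>The action on 2-cochains of \<open>L\<close> dual to the adjoint action on the ideal \<open>L\<close>.\<close>

definition coadjoint2 :: "'a set \<Rightarrow> 'a \<Rightarrow> ('a \<Rightarrow> 'a \<Rightarrow> complex) \<Rightarrow> 'a \<Rightarrow> 'a \<Rightarrow> complex" where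
  "coadjoint2 L g \<omega> = (\<lambda>x y. if x \<in> L \<and> y \<in> L
     then - \<omega> (bracket g x) y - \<omega> x (bracket g y) else 0)"

definition H2 :: "'a set \<Rightarrow> ('a, ('a \<Rightarrow> 'a \<Rightarrow> complex) set) lie_mod" where
  "H2 L =
    \<lparr>mcarrier = cocycles2 L // cohomologous L,
     madd = (\<lambda>A B. \<Union>\<omega>\<in>A. \<Union>\<omega>'\<in>B. cohomologous L `` {\<lambda>x y. \<omega> x y + \<omega>' x y}),
     mscale = (\<lambda>c A. \<Union>\<omega>\<in>A. cohomologous L `` {\<lambda>x y. c * \<omega> x y}),
     mact = (\<lambda>g A. \<Union>\<omega>\<in>A. cohomologous L `` {coadjoint2 L g \<omega>})\<rparr>"

lemma coboundaries2_subset_cocycles2: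
  assumes "subspace L" and "\<And>x y. x \<in> L \<Longrightarrow> y \<in> L \<Longrightarrow> bracket x y \<in> L"
  shows "coboundaries2 L \<subseteq> cocycles2 L"
proof
  fix \<omega> assume "\<omega> \<in> coboundaries2 L"
  then obtain \<eta> where \<eta>: "\<eta> \<in> cochains1 L" and \<omega>: "\<omega> = diff1 L \<eta>"
    unfolding coboundaries2_def by blast
  have add: "\<eta> (x + y) = \<eta> x + \<eta> y" if "x \<in> L" "y \<in> L" for x y
    using \<eta> that unfolding cochains1_def by blast
  have scl: "\<eta> (scale c x) = c * \<eta> x" if "x \<in> L" for x c
    using \<eta> that unfolding cochains1_def by blast
  have zero: "\<eta> 0 = 0"
    using scl[of 0 0] subspace_0[OF assms(1)] by simp
  have "\<omega> \<in> cochains2 L"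
    unfolding cochains2_def \<omega> diff1_def
    by (auto simp: bracket_add_left bracket_add_right bracket_scale_left bracket_scale_right
        bracket_self add scl zero assms(2) subspace_add[OF assms(1)] subspace_scale[OF assms(1)])
  moreover have "diff2 L \<omega> x y z = 0" for x y z
  proof (cases "x \<in> L \<and> y \<in> L \<and> z \<in> L")
    case True
    then have L: "x \<in> L" "y \<in> L" "z \<in> L" by auto
    let ?J1 = "bracket (bracket x y) z" and ?J2 = "bracket (bracket x z) y"
      and ?J3 = "bracket (bracket y z) x"
    have "?J1 + ?J3 = ?J2"
    proof -
      have "?J2 = bracket y (bracket z x)"
        using bracket_skew[of y "bracket x z"] bracket_scale_right[of y "- 1" "bracket x z"]
        by (simp add: bracket_skew[of z x])
      moreover have "?J3 = - bracket x (bracket y z)" "?J1 = - bracket z (bracket x y)"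
        by (rule bracket_skew)+
      ultimately show ?thesis
        using jacobi[of x y z] by (metis (no_types, lifting) add.assoc add.commute
            add_eq_0_iff minus_add_distrib minus_minus)
    qed
    then have "\<eta> ?J1 + \<eta> ?J3 = \<eta> ?J2"
      using L assms(2) by (metis add)
    then show ?thesis
      using L by (simp add: diff2_def \<omega> diff1_def assms(2) algebra_simps)
  next
    case False
    then show ?thesis by (auto simp: diff2_def)
  qed
  ultimately show "\<omega> \<in> cocycles2 L"
    unfolding cocycles2_def by (auto simp: fun_eq_iff)
qed

text \<open>\<open>L\<close> acts trivially on its own cohomology, so the action on \<open>H2 L\<close> factors modulo \<open>L\<close>.\<close>

lemma coadjoint2_mem_coboundaries2:
  assumes "\<And>x y. x \<in> L \<Longrightarrow> y \<in> L \<Longrightarrow> bracket x y \<in> L"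
    and "g \<in> L" and "\<omega> \<in> cocycles2 L"
  shows "coadjoint2 L g \<omega> \<in> coboundaries2 L"
proof -
  let ?\<eta> = "\<lambda>x. \<omega> g x"
  have \<omega>: "\<omega> \<in> cochains2 L" and closed: "diff2 L \<omega> x y z = 0" for x y z
    using assms(3) by (auto simp: cocycles2_def)
  have \<eta>: "?\<eta> \<in> cochains1 L"
    using \<omega> assms(2) unfolding cochains1_def cochains2_def by auto
  have skew: "\<omega> y x = - \<omega> x y" if "x \<in> L" "y \<in> L" for x y
  proof (cases "x + y \<in> L")
    case True
    have "\<omega> (x + y) (x + y) = 0" "\<omega> x x = 0" "\<omega> y y = 0"
      using \<omega> that True unfolding cochains2_def by auto
    moreover have "\<omega> (x + y) (x + y) = \<omega> x (x + y) + \<omega> y (x + y)"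
      "\<omega> x (x + y) = \<omega> x x + \<omega> x y" "\<omega> y (x + y) = \<omega> y x + \<omega> y y"
      using \<omega> that True unfolding cochains2_def by blast+
    ultimately show ?thesis by (simp add: eq_neg_iff_add_eq_0 add.commute)
  next
    case False
    then have "\<omega> x (x + y) = 0" "\<omega> y (x + y) = 0" "\<omega> x x = 0" "\<omega> y y = 0"
      using \<omega> that unfolding cochains2_def by auto
    moreover have "\<omega> x (x + y) = \<omega> x x + \<omega> x y" "\<omega> y (x + y) = \<omega> y x + \<omega> y y"
      using \<omega> that unfolding cochains2_def by blast+
    ultimately show ?thesis by simp
  qed
  have "coadjoint2 L g \<omega> = diff1 L ?\<eta>"
  proof (intro ext)
    fix x y
    show "coadjoint2 L g \<omega> x y = diff1 L ?\<eta> x y"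
    proof (cases "x \<in> L \<and> y \<in> L")
      case True
      then have "- \<omega> (bracket g x) y + \<omega> (bracket g y) x - \<omega> (bracket x y) g = 0"
        using closed[of g x y] assms(2) by (simp add: diff2_def)
      moreover have "\<omega> (bracket g y) x = - \<omega> x (bracket g y)"
        "\<omega> (bracket x y) g = - \<omega> g (bracket x y)"
        using True assms(1,2) by (auto intro: skew)
      ultimately show ?thesis
        using True by (simp add: coadjoint2_def diff1_def eq_neg_iff_add_eq_0 algebra_simps)
    next
      case False
      then show ?thesis by (auto simp: coadjoint2_def diff1_def)
    qed
  qed
  with \<eta> show ?thesis unfolding coboundaries2_def by blast
qed

end


subsection \<open>Constructions on modules\<close>

text \<open>
  The module over \<open>\<pi> ` G\<close> through which the action of \<open>G\<close> on \<open>M\<close> factors: \<open>y\<close> acts as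
  any of its preimages, \<open>the_elem\<close> being meaningful only if all of them act alike.
\<close>

definition factored_module ::
    "('g \<Rightarrow> 'h) \<Rightarrow> 'g set \<Rightarrow> ('g, 'v) lie_mod \<Rightarrow> ('h, 'v) lie_mod" where
  "factored_module \<pi> G M =
    \<lparr>mcarrier = mcarrier M, madd = madd M, mscale = mscale M,
     mact = (\<lambda>y u. the_elem ((\<lambda>x. mact M x u) ` {x \<in> G. \<pi> x = y}))\<rparr>"

definition direct_sum :: "('g, 'v) lie_mod \<Rightarrow> ('g, 'w) lie_mod \<Rightarrow> ('g, 'v \<times> 'w) lie_mod"
    (infixr "\<oplus>\<^sub>m" 65) where
  "M \<oplus>\<^sub>m N =
    \<lparr>mcarrier = mcarrier M \<times> mcarrier N,
     madd = (\<lambda>(u, w) (u', w'). (madd M u u', madd N w w')),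
     mscale = (\<lambda>c (u, w). (mscale M c u, mscale N c w)),
     mact = (\<lambda>x (u, w). (mact M x u, mact N x w))\<rparr>"

text \<open>Modules whose elements are coordinate functions, with pointwise vector space operations.\<close>

definition coord_module ::
    "('i \<Rightarrow> complex) set \<Rightarrow> ('g \<Rightarrow> ('i \<Rightarrow> complex) \<Rightarrow> 'i \<Rightarrow> complex) \<Rightarrow> ('g, 'i \<Rightarrow> complex) lie_mod" where
  "coord_module W \<rho> =
    \<lparr>mcarrier = W, madd = (\<lambda>u v i. u i + v i), mscale = (\<lambda>c u i. c * u i), mact = \<rho>\<rparr>"

definition trivial_module :: "('g, unit \<Rightarrow> complex) lie_mod" where
  "trivial_module = coord_module UNIV (\<lambda>x u i. 0)"

definition tensor :: "('i \<Rightarrow> complex) \<Rightarrow> ('j \<Rightarrow> complex) \<Rightarrow> 'i \<times> 'j \<Rightarrow> complex" (infixr "\<otimes>\<^sub>v" 70) where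
  "v \<otimes>\<^sub>v w = (\<lambda>(i, j). v i * w j)"

text \<open>
  External tensor product of two coordinate modules: all finite sums of pure tensors,
  realised inside the functions on the product of the index types. The first factor acts
  on the first coordinate and the second on the second, see \<open>ext_tensor_act_pure\<close>.
\<close>

definition ext_tensor ::
    "('g, 'i \<Rightarrow> complex) lie_mod \<Rightarrow> ('h, 'j \<Rightarrow> complex) lie_mod \<Rightarrow>
     ('g \<times> 'h, 'i \<times> 'j \<Rightarrow> complex) lie_mod" (infixr "\<boxtimes>" 70) where
  "V \<boxtimes> W = coord_module
     {T. \<exists>(n::nat) v w. (\<forall>k<n. v k \<in> mcarrier V \<and> w k \<in> mcarrier W) \<and>
        T = (\<lambda>ij. \<Sum>k<n. (v k \<otimes>\<^sub>v w k) ij)}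
     (\<lambda>(x, y) T (i, j). mact V x (\<lambda>i'. T (i', j)) i + mact W y (\<lambda>j'. T (i, j')) j)"

lemma ext_tensor_act_pure:
  assumes V: "V = coord_module A \<rho>" and W: "W = coord_module B \<sigma>"
    and "complex_lie_algebra.lie_module s1 b1 G V" "complex_lie_algebra s1 b1"
    and "complex_lie_algebra.lie_module s2 b2 H W" "complex_lie_algebra s2 b2"
    and "x \<in> G" "y \<in> H" "v \<in> A" "w \<in> B"
  shows "mact (V \<boxtimes> W) (x, y) (v \<otimes>\<^sub>v w) = (\<lambda>ij. (\<rho> x v \<otimes>\<^sub>v w) ij + (v \<otimes>\<^sub>v \<sigma> y w) ij)"
proof -
  have "\<rho> x (\<lambda>i. v i * c) = (\<lambda>i. \<rho> x v i * c)" for c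
    using assms(3,7,9) unfolding complex_lie_algebra.lie_module_def[OF assms(4)] V
    by (simp add: coord_module_def mult.commute)
  moreover have "\<sigma> y (\<lambda>j. c * w j) = (\<lambda>j. c * \<sigma> y w j)" for c
    using assms(5,8,10) unfolding complex_lie_algebra.lie_module_def[OF assms(6)] W
    by (simp add: coord_module_def)
  ultimately show ?thesis
    by (auto simp: ext_tensor_def coord_module_def tensor_def V W fun_eq_iff)
qed


section \<open>\<open>sl\<^sub>2\<close>, its current algebra and its irreducible modules\<close>

type_synonym cmat = "complex^2^2"
type_synonym pmat = "complex poly^2^2"

definition commutator :: "'a::ring_1^'n^'n \<Rightarrow> 'a^'n^'n \<Rightarrow> 'a^'n^'n" where
  "commutator A B = A ** B - B ** A"

lemmas mat2_simps = vec_eq_iff forall_2 sum_2 matrix_matrix_mult_def commutator_def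

interpretation gl2: complex_lie_algebra "\<lambda>c. map_matrix ((*) c)" "commutator :: cmat \<Rightarrow> cmat \<Rightarrow> cmat"
  by unfold_locales (simp_all add: mat2_simps algebra_simps)

text \<open>Polynomial matrices are the model of \<open>gl\<^sub>2 \<otimes> \<complex>[t]\<close>.\<close>

interpretation gl2t: complex_lie_algebra "\<lambda>c. map_matrix (smult c)" "commutator :: pmat \<Rightarrow> pmat \<Rightarrow> pmat"
  by unfold_locales (simp_all add: mat2_simps algebra_simps smult_add_left smult_add_right smult_diff_right)

interpretation gl2_gl2: complex_lie_algebra
  "\<lambda>c (x, y). (map_matrix ((*) c) x, map_matrix ((*) c) y)"
  "\<lambda>(x :: cmat, y :: cmat) (x', y'). (commutator x x', commutator y y')"
  by unfold_locales
    (auto simp: gl2.bracket_add_left gl2.bracket_add_right gl2.bracket_scale_left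
      gl2.bracket_scale_right gl2.bracket_self gl2.jacobi gl2.scale_right_distrib
      gl2.scale_left_distrib simp flip: zero_prod_def)

definition sl2 :: "cmat set" where
  "sl2 = {x. trace x = 0}"

definition pure_tensor :: "cmat \<Rightarrow> complex poly \<Rightarrow> pmat" where
  "pure_tensor x p = map_matrix (\<lambda>c. smult c p) x"

definition sl2_tensor :: "complex poly set \<Rightarrow> pmat set" where
  "sl2_tensor I = gl2t.span {pure_tensor x p |x p. x \<in> sl2 \<and> p \<in> I}"

definition eval_at :: "complex \<Rightarrow> pmat \<Rightarrow> cmat" where
  "eval_at a g = map_matrix (\<lambda>p. poly p a) g"

lemma commutator_pure_tensor:
  "commutator (pure_tensor x p) (pure_tensor y q) = pure_tensor (commutator x y) (p * q)"
  by (simp add: mat2_simps pure_tensor_def algebra_simps smult_add_left smult_diff_left)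

lemma eval_at_pure_tensor: "eval_at a (pure_tensor x p) = map_matrix ((*) (poly p a)) x"
  by (simp add: eval_at_def pure_tensor_def mat2_simps mult.commute)

lemma mem_sl2_iff: "x \<in> sl2 \<longleftrightarrow> x $ 2 $ 2 = - x $ 1 $ 1"
  by (auto simp: sl2_def trace_def sum_2 eq_neg_iff_add_eq_0 add.commute)

lemma mem_sl2_tensor_iff:
  assumes "0 \<in> I" and "\<And>p q. p \<in> I \<Longrightarrow> q \<in> I \<Longrightarrow> p + q \<in> I" and "\<And>c p. p \<in> I \<Longrightarrow> smult c p \<in> I"
  shows "g \<in> sl2_tensor I \<longleftrightarrow> trace g = 0 \<and> (\<forall>i j. g $ i $ j \<in> I)"
proof
  assume "g \<in> sl2_tensor I"
  then show "trace g = 0 \<and> (\<forall>i j. g $ i $ j \<in> I)"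
    unfolding sl2_tensor_def
  proof (induction rule: gl2t.span_induct_alt)
    case base
    then show ?case using assms(1) by (simp add: trace_def)
  next
    case (step c y z)
    then obtain x p where "y = pure_tensor x p" "x \<in> sl2" "p \<in> I" by blast
    moreover have "trace (pure_tensor x p) = 0" if "x \<in> sl2"
      using that by (simp add: mem_sl2_iff trace_def sum_2 pure_tensor_def)
    ultimately show ?case using step.IH assms(2,3)
      by (auto simp: trace_def sum_2 pure_tensor_def mem_sl2_iff simp flip: smult_add_left)
  qed
next
  assume g: "trace g = 0 \<and> (\<forall>i j. g $ i $ j \<in> I)"
  let ?h = "(\<chi> k l. if k = 1 \<and> l = 1 then 1 else if k = 2 \<and> l = 2 then - 1 else 0) :: cmat"
  let ?e = "(\<chi> k l. if k = 1 \<and> l = 2 then 1 else 0) :: cmat"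
  let ?f = "(\<chi> k l. if k = 2 \<and> l = 1 then 1 else 0) :: cmat"
  have "?h \<in> sl2" "?e \<in> sl2" "?f \<in> sl2"
    by (simp_all add: mem_sl2_iff)
  then have "pure_tensor ?h (g $ 1 $ 1) + pure_tensor ?e (g $ 1 $ 2) + pure_tensor ?f (g $ 2 $ 1)
      \<in> sl2_tensor I"
    unfolding sl2_tensor_def using g by (intro gl2t.span_add gl2t.span_base) blast+
  moreover have "g $ 2 $ 2 = - g $ 1 $ 1"
    using g by (auto simp: trace_def sum_2 eq_neg_iff_add_eq_0 add.commute)
  then have "pure_tensor ?h (g $ 1 $ 1) + pure_tensor ?e (g $ 1 $ 2) + pure_tensor ?f (g $ 2 $ 1) = g"
    by (simp add: vec_eq_iff forall_2 pure_tensor_def)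
  ultimately show "g \<in> sl2_tensor I" by simp
qed

text \<open>
  Coordinates with respect to the basis \<open>v\<^sub>0, \<dots>, v\<^sub>m\<close> with \<open>h v\<^sub>i = (m - 2 i) v\<^sub>i\<close>,
  \<open>e v\<^sub>i = (m - i + 1) v\<^sub>i\<^sub>-\<^sub>1\<close> and \<open>f v\<^sub>i = (i + 1) v\<^sub>i\<^sub>+\<^sub>1\<close>, where a traceless matrix \<open>x\<close> is
  \<open>x\<^sub>1\<^sub>1 h + x\<^sub>1\<^sub>2 e + x\<^sub>2\<^sub>1 f\<close>.
\<close>

definition sl2_irrep :: "nat \<Rightarrow> (cmat, nat \<Rightarrow> complex) lie_mod" where
  "sl2_irrep m = coord_module {v. \<forall>i>m. v i = 0}
     (\<lambda>x v i. if i \<le> m then x $ 1 $ 1 * (of_nat m - 2 * of_nat i) * v i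
        + x $ 1 $ 2 * (of_nat m - of_nat i) * v (Suc i)
        + x $ 2 $ 1 * of_nat i * v (i - 1) else 0)"

lemma lie_module_sl2_irrep: "gl2.lie_module sl2 (sl2_irrep m)"
proof -
  let ?M = "sl2_irrep m"
  have "madd ?M (mact ?M (commutator x y) u) (mact ?M y (mact ?M x u)) = mact ?M x (mact ?M y u)"
    if "x \<in> sl2" "y \<in> sl2" "u \<in> mcarrier ?M" for x y u
  proof (rule ext)
    fix i
    have u: "u j = 0" if "m < j" for j
      using \<open>u \<in> mcarrier ?M\<close> that by (simp add: sl2_irrep_def coord_module_def)
    show "madd ?M (mact ?M (commutator x y) u) (mact ?M y (mact ?M x u)) i = mact ?M x (mact ?M y u) i"
    proof (cases i)
      case 0
      then show ?thesis using that(1,2) u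
        by (cases m) (simp_all add: sl2_irrep_def coord_module_def mat2_simps mem_sl2_iff algebra_simps)
    next
      case (Suc j)
      consider "i > m" | "i = m" | "i < m" by linarith
      then show ?thesis
      proof cases
        case 1
        then show ?thesis by (simp add: sl2_irrep_def coord_module_def)
      next
        case 2
        with Suc show ?thesis using that(1,2) u
          by (cases j) (simp_all add: sl2_irrep_def coord_module_def mat2_simps mem_sl2_iff algebra_simps)
      next
        case 3
        with Suc show ?thesis using that(1,2)
          by (cases j) (simp_all add: sl2_irrep_def coord_module_def mat2_simps mem_sl2_iff algebra_simps)
      qed
    qed
  qed
  then show ?thesis
    unfolding gl2.lie_module_def submodule_def
    by (auto simp: sl2_irrep_def coord_module_def fun_eq_iff algebra_simps intro: exI[of _ "\<lambda>_. 0"])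
qed

lemma sl2_irrep_highest_weight:
  assumes "x \<in> sl2" and "x $ 2 $ 1 = 0" and "v = (\<lambda>i. if i = 0 then 1 else 0)"
  shows "v \<in> mcarrier (sl2_irrep m)"
    and "mact (sl2_irrep m) x v = mscale (sl2_irrep m) (x $ 1 $ 1 * of_nat m) v"
  using assms by (auto simp: sl2_irrep_def coord_module_def fun_eq_iff)

lemma irreducible_sl2_irrep: "gl2.irreducible_module sl2 (sl2_irrep m)"
proof -
  let ?M = "sl2_irrep m"
  define \<delta> :: "nat \<Rightarrow> nat \<Rightarrow> complex" where "\<delta> k = (\<lambda>i. if i = k then 1 else 0)" for k
  have carrier: "mcarrier ?M = {v. \<forall>i>m. v i = 0}"
    by (simp add: sl2_irrep_def coord_module_def)
  have "(\<lambda>_. 0) \<in> mcarrier ?M" "\<delta> 0 \<in> mcarrier ?M" "(\<lambda>_. 0) \<noteq> \<delta> 0"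
    by (auto simp: carrier \<delta>_def fun_eq_iff)
  then have nontrivial: "\<not> is_singleton (mcarrier ?M)"
    by (metis is_singletonE singletonD)
  have "W = mcarrier ?M" if W: "submodule sl2 ?M W" and "\<not> is_singleton W" for W
  proof -
    have sub: "W \<subseteq> mcarrier ?M" "W \<noteq> {}"
      using W by (auto simp: submodule_def)
    have add: "(\<lambda>i. u i + v i) \<in> W" if "u \<in> W" "v \<in> W" for u v
      using W that by (auto simp: submodule_def sl2_irrep_def coord_module_def)
    have scl: "(\<lambda>i. c * u i) \<in> W" if "u \<in> W" for c u
      using W that by (auto simp: submodule_def sl2_irrep_def coord_module_def)
    have act: "mact ?M x u \<in> W" if "x \<in> sl2" "u \<in> W" for x u
      using W that by (auto simp: submodule_def)
    let ?e = "(\<chi> i j. if i = 1 \<and> j = 2 then 1 else 0) :: cmat"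
    let ?f = "(\<chi> i j. if i = 2 \<and> j = 1 then 1 else 0) :: cmat"
    have sl2: "?e \<in> sl2" "?f \<in> sl2"
      by (simp_all add: mem_sl2_iff)
    have e: "(\<lambda>i. if i \<le> m then (of_nat m - of_nat i) * u (Suc i) else 0) \<in> W" if "u \<in> W" for u
      using act[OF sl2(1) that] by (simp add: sl2_irrep_def coord_module_def cong: if_cong)
    have f: "(\<lambda>i. if i \<le> m then of_nat i * u (i - 1) else 0) \<in> W" if "u \<in> W" for u
      using act[OF sl2(2) that] by (simp add: sl2_irrep_def coord_module_def cong: if_cong)
    have top: "\<delta> 0 \<in> W" if "u \<in> W" "u k \<noteq> 0" "\<forall>i>k. u i = 0" for u k
      using that
    proof (induction k arbitrary: u)
      case 0
      have "\<delta> 0 = (\<lambda>i. inverse (u 0) * u i)"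
        using 0 by (auto simp: \<delta>_def fun_eq_iff)
      then show ?case using scl[OF 0(1)] by simp
    next
      case (Suc k)
      have "k < m"
        using Suc.prems(1,2) sub(1) carrier by (metis (mono_tags, lifting) mem_Collect_eq
            Suc_le_eq not_less subsetD)
      then show ?case
        using Suc.prems by (intro Suc.IH[OF e[OF Suc.prems(1)]]) auto
    qed
    have zero: "(\<lambda>_. 0) \<in> W"
      using sub(2) scl[of _ 0] by auto
    moreover have "W \<noteq> {\<lambda>_. 0}"
      using \<open>\<not> is_singleton W\<close> by auto
    ultimately obtain u where u: "u \<in> W" "u \<noteq> (\<lambda>_. 0)"
      by blast
    define k where "k = (GREATEST i. u i \<noteq> 0)"
    have bound: "i \<le> m" if "u i \<noteq> 0" for i
      using that u(1) sub(1) carrier by (auto simp: not_less[symmetric])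
    obtain j where "u j \<noteq> 0" using u(2) by auto
    then have "u k \<noteq> 0"
      unfolding k_def using bound by (rule GreatestI_nat)
    moreover have "i \<le> k" if "u i \<noteq> 0" for i
      unfolding k_def using that bound by (rule Greatest_le_nat)
    then have "\<forall>i>k. u i = 0"
      using not_less by blast
    ultimately have \<delta>0: "\<delta> 0 \<in> W" using top u(1) by blast
    have \<delta>: "\<delta> k \<in> W" if "k \<le> m" for k
      using that
    proof (induction k)
      case 0
      show ?case by (rule \<delta>0)
    next
      case (Suc k)
      then have "\<delta> k \<in> W" by simp
      then have "(\<lambda>i. inverse (of_nat (Suc k)) * (if i \<le> m then of_nat i * \<delta> k (i - 1) else 0)) \<in> W"
        by (intro scl f)
      moreover have "(\<lambda>i. inverse (of_nat (Suc k)) * (if i \<le> m then of_nat i * \<delta> k (i - 1) else 0)) = \<delta> (Suc k)"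
        using Suc.prems by (auto simp: \<delta>_def fun_eq_iff simp del: of_nat_Suc)
      ultimately show ?case by simp
    qed
    have "v \<in> W" if v: "\<forall>i>m. v i = 0" for v
    proof -
      have "(\<lambda>i. if i < n then v i else 0) \<in> W" if "n \<le> Suc m" for n
        using that
      proof (induction n)
        case 0
        then show ?case using zero by simp
      next
        case (Suc n)
        then have "(\<lambda>i. (if i < n then v i else 0) + v n * \<delta> n i) \<in> W"
          by (intro add scl \<delta>) auto
        moreover have "(\<lambda>i. (if i < n then v i else 0) + v n * \<delta> n i) = (\<lambda>i. if i < Suc n then v i else 0)"
          by (auto simp: \<delta>_def fun_eq_iff less_Suc_eq)
        ultimately show ?case by simp
      qed
      moreover have "(\<lambda>i. if i < Suc m then v i else 0) = v"
        using v by (auto simp: fun_eq_iff)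
      ultimately show ?thesis by force
    qed
    then show ?thesis using sub(1) carrier by auto
  qed
  then show ?thesis
    unfolding gl2.irreducible_module_def using lie_module_sl2_irrep nontrivial by blast
qed

end

theory Submission
  imports Defs
begin

text \<open>
  A 2-cochain on \<open>sl\<^sub>2 \<otimes> I\<close> is determined by its components \<open>\<omega> (X \<otimes> f u) (Y \<otimes> f v)\<close>, where
  \<open>X, Y\<close> run through the standard basis of \<open>sl\<^sub>2\<close>. The cocycle condition decouples, by
  \<open>sl\<^sub>2 \<otimes> sl\<^sub>2 = V(0) \<oplus> V(2) \<oplus> V(4)\<close>, into three identities for bilinear forms on \<open>\<complex>[t]\<close>: the
  \<open>V(4)\<close>-parts are skew forms with \<open>C(f u v, w)\<close> totally symmetric, spanned by the jet forms
  \<open>u v' - u' v\<close> at \<open>a\<close> and \<open>b\<close> and the cross form \<open>u(a) v(b) - u(b) v(a)\<close>; the \<open>V(2)\<close>-part is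
  symmetric with the same property, and up to a functional of \<open>u v\<close>, which is a coboundary, only
  the symmetrised cross form survives; the \<open>V(0)\<close>-part is a cyclic cocycle, spanned by the cross
  form and the period \<open>\<integral>\<^sub>a\<^sup>b f u (f v)' dt\<close>. Accordingly the cohomology is represented by the
  explicit cocycles built from the period of \<open>trace (g h')\<close> (the trivial summand), from
  \<open>g'(a), h'(b)\<close> (the summand \<open>V(2) \<boxtimes> V(2)\<close>), and from \<open>g'(c), h''(c)\<close> for \<open>c = a\<close> and \<open>c = b\<close>
  (the two copies of \<open>V(4)\<close>). An element of \<open>sl\<^sub>2 \<times> sl\<^sub>2\<close> is lifted by Hermite interpolation to
  a current with zero derivative at \<open>a\<close> and \<open>b\<close>, which makes equivariance a pointwise
  computation.
\<close>

section \<open>Second cohomology as a quotient\<close>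

context complex_lie_algebra
begin

lemma cochains1_lincomb:
  "\<lbrakk>\<eta> \<in> cochains1 L; \<theta> \<in> cochains1 L\<rbrakk> \<Longrightarrow> (\<lambda>x. c * \<eta> x + d * \<theta> x) \<in> cochains1 L"
  by (auto simp: cochains1_def algebra_simps)

lemma cochains2_lincomb:
  "\<lbrakk>\<omega> \<in> cochains2 L; \<theta> \<in> cochains2 L\<rbrakk> \<Longrightarrow> (\<lambda>x y. c * \<omega> x y + d * \<theta> x y) \<in> cochains2 L"
  by (auto simp: cochains2_def algebra_simps)

lemma diff1_lincomb:
  "diff1 L (\<lambda>x. c * \<eta> x + d * \<theta> x) = (\<lambda>x y. c * diff1 L \<eta> x y + d * diff1 L \<theta> x y)"
  by (auto simp: diff1_def fun_eq_iff)

lemma diff2_lincomb: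
  "diff2 L (\<lambda>x y. c * \<omega> x y + d * \<theta> x y) = (\<lambda>x y z. c * diff2 L \<omega> x y z + d * diff2 L \<theta> x y z)"
  by (auto simp: diff2_def fun_eq_iff algebra_simps)

lemma coadjoint2_lincomb:
  "coadjoint2 L g (\<lambda>x y. c * \<omega> x y + d * \<theta> x y) =
    (\<lambda>x y. c * coadjoint2 L g \<omega> x y + d * coadjoint2 L g \<theta> x y)"
  by (auto simp: coadjoint2_def fun_eq_iff algebra_simps)

lemma cocycles2_lincomb:
  "\<lbrakk>\<omega> \<in> cocycles2 L; \<theta> \<in> cocycles2 L\<rbrakk> \<Longrightarrow> (\<lambda>x y. c * \<omega> x y + d * \<theta> x y) \<in> cocycles2 L"
  by (auto simp: cocycles2_def cochains2_lincomb diff2_lincomb)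

lemma coboundaries2_lincomb:
  assumes "\<omega> \<in> coboundaries2 L" "\<theta> \<in> coboundaries2 L"
  shows "(\<lambda>x y. c * \<omega> x y + d * \<theta> x y) \<in> coboundaries2 L"
proof -
  obtain \<eta> \<eta>' where "\<eta> \<in> cochains1 L" "\<omega> = diff1 L \<eta>" "\<eta>' \<in> cochains1 L" "\<theta> = diff1 L \<eta>'"
    using assms unfolding coboundaries2_def by blast
  then show ?thesis
    unfolding coboundaries2_def by (auto simp: diff1_lincomb[symmetric] intro!: imageI
        cochains1_lincomb)
qed

lemma coboundaries2_0: "(\<lambda>x y. 0) \<in> coboundaries2 L"
  unfolding coboundaries2_def cochains1_def diff1_def
      by (auto simp: image_iff fun_eq_iff intro!: exI[of _ "\<lambda>_. 0"])

lemma cohomologous_iff: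
  "(\<omega>, \<theta>) \<in> cohomologous L \<longleftrightarrow> \<omega> \<in> cocycles2 L \<and> \<theta> \<in> cocycles2 L \<and>
    (\<lambda>x y. \<omega> x y - \<theta> x y) \<in> coboundaries2 L"
  by (simp add: cohomologous_def)

lemma equiv_cohomologous: "equiv (cocycles2 L) (cohomologous L)"
proof (rule equivI)
  show "refl_on (cocycles2 L) (cohomologous L)"
    by (rule refl_onI) (auto simp: cohomologous_iff coboundaries2_0)
  show "sym (cohomologous L)"
    by (rule symI) (use coboundaries2_lincomb[of _ L _ "- 1" 0] in \<open>force simp: cohomologous_iff\<close>)
  show "trans (cohomologous L)"
  proof (rule transI)
    fix \<omega> \<theta> \<psi> assume "(\<omega>, \<theta>) \<in> cohomologous L" "(\<theta>, \<psi>) \<in> cohomologous L"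
    then show "(\<omega>, \<psi>) \<in> cohomologous L"
      using coboundaries2_lincomb[of "\<lambda>x y. \<omega> x y - \<theta> x y" L "\<lambda>x y. \<theta> x y - \<psi> x y" 1 1]
      by (auto simp: cohomologous_iff)
  qed
qed (auto simp: cohomologous_iff)

lemma H2_carrier: "mcarrier (H2 L) = cocycles2 L // cohomologous L"
  by (simp add: H2_def)

text \<open>The operations of \<open>H2\<close> are unions over all representatives. Once the result
  is seen to be independent of the representatives, the union collapses to a single class; the next
  lemma and \<open>H2_mact_class\<close> follow the same pattern.\<close>

lemma H2_madd_class:
  assumes "\<omega> \<in> cocycles2 L" "\<theta> \<in> cocycles2 L"
  shows "madd (H2 L) (cohomologous L `` {\<omega>}) (cohomologous L `` {\<theta>}) =
    cohomologous L `` {\<lambda>x y. \<omega> x y + \<theta> x y}"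
proof -
  have "congruent2 (cohomologous L) (cohomologous L)
      (\<lambda>\<omega> \<theta>. cohomologous L `` {\<lambda>x y. \<omega> x y + \<theta> x y})"
  proof (rule congruent2I', rule equiv_class_eq[OF equiv_cohomologous])
    fix \<omega> \<omega>' \<theta> \<theta>' assume h: "(\<omega>, \<omega>') \<in> cohomologous L" "(\<theta>, \<theta>') \<in> cohomologous L"
    then show "(\<lambda>x y. \<omega> x y + \<theta> x y, \<lambda>x y. \<omega>' x y + \<theta>' x y) \<in> cohomologous L"
      using coboundaries2_lincomb[of "\<lambda>x y. \<omega> x y - \<omega>' x y" L "\<lambda>x y. \<theta> x y - \<theta>' x y" 1 1]
        cocycles2_lincomb[of \<omega> L \<theta> 1 1] cocycles2_lincomb[of \<omega>' L \<theta>' 1 1]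
      by (auto simp: cohomologous_iff algebra_simps)
  qed
  from UN_equiv_class2[OF equiv_cohomologous equiv_cohomologous this assms] show ?thesis
    by (simp only: H2_def lie_mod.select_convs)
qed

lemma H2_mscale_class:
  assumes "\<omega> \<in> cocycles2 L"
  shows "mscale (H2 L) c (cohomologous L `` {\<omega>}) = cohomologous L `` {\<lambda>x y. c * \<omega> x y}"
proof -
  have "congruent (cohomologous L) (\<lambda>\<omega>. cohomologous L `` {\<lambda>x y. c * \<omega> x y})"
  proof (rule congruentI, rule equiv_class_eq[OF equiv_cohomologous])
    fix \<omega> \<theta> assume h: "(\<omega>, \<theta>) \<in> cohomologous L"
    then show "(\<lambda>x y. c * \<omega> x y, \<lambda>x y. c * \<theta> x y) \<in> cohomologous L"
      using coboundaries2_lincomb[of "\<lambda>x y. \<omega> x y - \<theta> x y" L "\<lambda>x y. \<omega> x y - \<theta> x y" c 0]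
        cocycles2_lincomb[of \<omega> L \<omega> c 0] cocycles2_lincomb[of \<theta> L \<theta> c 0]
      by (auto simp: cohomologous_iff algebra_simps)
  qed
  from UN_equiv_class[OF equiv_cohomologous this assms] show ?thesis
    by (simp only: H2_def lie_mod.select_convs)
qed

lemma cochains2_skew:
  assumes "\<omega> \<in> cochains2 L" "subspace L" "x \<in> L" "y \<in> L"
  shows "\<omega> y x = - \<omega> x y"
proof -
  have "\<omega> (x + y) (x + y) = \<omega> x (x + y) + \<omega> y (x + y)"
    "\<omega> x (x + y) = \<omega> x x + \<omega> x y" "\<omega> y (x + y) = \<omega> y x + \<omega> y y"
    using assms subspace_add[OF assms(2)] unfolding cochains2_def by blast+
  moreover have "\<omega> (x + y) (x + y) = 0" "\<omega> x x = 0" "\<omega> y y = 0"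
    using assms subspace_add[OF assms(2)] unfolding cochains2_def by blast+
  ultimately show ?thesis by (simp add: eq_neg_iff_add_eq_0 add.commute)
qed

text \<open>The Jacobi identity as a Leibniz rule; in this form it makes the coadjoint action
  compatible with \<open>diff1\<close> and \<open>diff2\<close>.\<close>

lemma bracket_derivation: "bracket g (bracket x y) = bracket (bracket g x) y
    + bracket x (bracket g y)"
proof -
  have "bracket g (bracket x y) = - (bracket x (bracket y g) + bracket y (bracket g x))"
    using jacobi[of g x y] by (simp only: eq_neg_iff_add_eq_0 add.assoc)
  also have "bracket x (bracket y g) = - bracket x (bracket g y)"
    using bracket_scale_right[of x "- 1" "bracket g y"] by (simp add: bracket_skew[of y g])
  finally show ?thesis by (simp add: bracket_skew[of y "bracket g x"] add.commute)
qed

section \<open>Action on cohomology of an element that normalises \<open>L\<close> without having to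
  lie in it\<close>

context
  fixes L :: "'a set" and g :: 'a
  assumes L: "subspace L" and bracket_L: "\<And>x y. x \<in> L \<Longrightarrow> y \<in> L \<Longrightarrow> bracket x y \<in> L"
    and stable: "\<And>x. x \<in> L \<Longrightarrow> bracket g x \<in> L"
begin

lemma coadjoint2_cochains2:
  assumes "\<omega> \<in> cochains2 L"
  shows "coadjoint2 L g \<omega> \<in> cochains2 L"
proof -
  have "\<omega> (bracket g x) x = - \<omega> x (bracket g x)" if "x \<in> L" for x
    by (rule cochains2_skew[OF assms L]) (use that stable in auto)
  then show ?thesis
    using assms unfolding cochains2_def coadjoint2_def
    by (auto simp: subspace_add[OF L] subspace_scale[OF L] stable bracket_add_right
        bracket_scale_right algebra_simps)
qed

text \<open>The differential commutes with the action: by the Leibniz rule the differential of the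
  transformed cochain is minus the sum of \<open>diff2 L \<omega>\<close> with
  \<open>bracket g\<close> applied to one argument at a time.\<close>

lemma coadjoint2_cocycles2:
  assumes "\<omega> \<in> cocycles2 L"
  shows "coadjoint2 L g \<omega> \<in> cocycles2 L"
proof -
  have \<omega>: "\<omega> \<in> cochains2 L" and closed: "diff2 L \<omega> x y z = 0" for x y z
    using assms by (auto simp: cocycles2_def)
  have add: "\<omega> (x + y) z = \<omega> x z + \<omega> y z" if "x \<in> L" "y \<in> L" "z \<in> L" for x y z
    using \<omega> that unfolding cochains2_def by blast
  have "diff2 L (coadjoint2 L g \<omega>) x y z = 0" for x y z
  proof (cases "x \<in> L \<and> y \<in> L \<and> z \<in> L")
    case True
    then have "diff2 L (coadjoint2 L g \<omega>) x y z = - (diff2 L \<omega> (bracket g x) y z +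
        diff2 L \<omega> x (bracket g y) z + diff2 L \<omega> x y (bracket g z))"
      by (simp add: diff2_def coadjoint2_def stable bracket_L bracket_derivation[of g] add)
    then show ?thesis by (simp add: closed)
  qed (auto simp: diff2_def)
  then show ?thesis
    by (auto simp: cocycles2_def coadjoint2_cochains2[OF \<omega>] fun_eq_iff)
qed

lemma coadjoint2_coboundaries2:
  assumes "\<omega> \<in> coboundaries2 L"
  shows "coadjoint2 L g \<omega> \<in> coboundaries2 L"
proof -
  obtain \<eta> where \<eta>: "\<eta> \<in> cochains1 L" and \<omega>: "\<omega> = diff1 L \<eta>"
    using assms unfolding coboundaries2_def by blast
  \<comment> \<open>The new primitive is the result of letting \<open>g\<close> act on the old one,
    cut off outside \<open>L\<close> as \<open>cochains1\<close> demands.\<close>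
  define \<theta> where "\<theta> = (\<lambda>x. if x \<in> L then - \<eta> (bracket g x) else 0)"
  have add: "\<eta> (x + y) = \<eta> x + \<eta> y" if "x \<in> L" "y \<in> L" for x y
    using \<eta> that unfolding cochains1_def by blast
  have "\<theta> \<in> cochains1 L"
    using \<eta> by (auto simp: \<theta>_def cochains1_def subspace_add[OF L] subspace_scale[OF L] stable
        bracket_add_right bracket_scale_right)
  moreover have "coadjoint2 L g \<omega> = diff1 L \<theta>"
    by (auto simp: fun_eq_iff coadjoint2_def diff1_def \<omega> \<theta>_def bracket_L stable
        bracket_derivation[of g] add)
  ultimately show ?thesis unfolding coboundaries2_def by blast
qed

lemma H2_mact_class:
  assumes "\<omega> \<in> cocycles2 L"
  shows "mact (H2 L) g (cohomologous L `` {\<omega>}) = cohomologous L `` {coadjoint2 L g \<omega>}"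
proof -
  have "congruent (cohomologous L) (\<lambda>\<omega>. cohomologous L `` {coadjoint2 L g \<omega>})"
  proof (rule congruentI, rule equiv_class_eq[OF equiv_cohomologous])
    fix \<omega> \<theta> assume h: "(\<omega>, \<theta>) \<in> cohomologous L"
    then show "(coadjoint2 L g \<omega>, coadjoint2 L g \<theta>) \<in> cohomologous L"
      using coadjoint2_coboundaries2[of "\<lambda>x y. \<omega> x y - \<theta> x y"] coadjoint2_cocycles2
        coadjoint2_lincomb[of L g 1 \<omega> "- 1" \<theta>]
      by (auto simp: cohomologous_iff)
  qed
  from UN_equiv_class[OF equiv_cohomologous this assms] show ?thesis
    by (simp only: H2_def lie_mod.select_convs)
qed

end

text \<open>The two actions differ by that of \<open>h - g\<close>, and elements of \<open>L\<close>
  act by coboundaries. This is what gives \<open>the_elem\<close> in \<open>factored_module\<close>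
  a meaning.\<close>

lemma H2_mact_class_cong:
  assumes L: "subspace L" "\<And>x y. x \<in> L \<Longrightarrow> y \<in> L \<Longrightarrow> bracket x y \<in> L"
    and g: "\<And>x. x \<in> L \<Longrightarrow> bracket g x \<in> L" and h: "\<And>x. x \<in> L \<Longrightarrow> bracket h x \<in> L"
    and gh: "h - g \<in> L" and \<omega>: "\<omega> \<in> cocycles2 L"
  shows "mact (H2 L) h (cohomologous L `` {\<omega>}) = mact (H2 L) g (cohomologous L `` {\<omega>})"
proof -
  have \<omega>': "\<omega> \<in> cochains2 L"
    using \<omega> by (simp add: cocycles2_def)
  have "bracket h x = bracket (h - g) x + bracket g x" for x
    using bracket_add_left[of "h - g" g x] by simp
  then have "coadjoint2 L h \<omega> x y - coadjoint2 L g \<omega> x y = coadjoint2 L (h - g) \<omega> x y" for x y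
    using \<omega>' g L(2) gh unfolding cochains2_def coadjoint2_def by (auto simp: algebra_simps)
  then have "(coadjoint2 L h \<omega>, coadjoint2 L g \<omega>) \<in> cohomologous L"
    using coadjoint2_cocycles2[OF L g \<omega>] coadjoint2_cocycles2[OF L h \<omega>]
      coadjoint2_mem_coboundaries2[OF L(2) gh \<omega>]
    by (simp add: cohomologous_iff)
  then show ?thesis
    using equiv_class_eq[OF equiv_cohomologous] by (simp add: H2_mact_class[OF L _ \<omega>] g h)
qed

text \<open>The module axioms are checked only on the explicit model \<open>N\<close> and carried to
  \<open>M\<close> along \<psi>. For this reason \<psi> runs from the model to \<open>M\<close>, and
  its inverse is the map that the definition asks for.\<close>

lemma isomorphic_modules_transport:
  assumes N: "lie_module G N" and bij: "bij_betw \<psi> (mcarrier N) (mcarrier M)"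
    and add: "\<And>u v. u \<in> mcarrier N \<Longrightarrow> v \<in> mcarrier N \<Longrightarrow> madd M (\<psi> u) (\<psi> v) = \<psi> (madd N u v)"
    and scl: "\<And>c u. u \<in> mcarrier N \<Longrightarrow> mscale M c (\<psi> u) = \<psi> (mscale N c u)"
    and act: "\<And>x u. x \<in> G \<Longrightarrow> u \<in> mcarrier N \<Longrightarrow> mact M x (\<psi> u) = \<psi> (mact N x u)"
    and G: "\<And>x y. x \<in> G \<Longrightarrow> y \<in> G \<Longrightarrow> x + y \<in> G" "\<And>c x. x \<in> G \<Longrightarrow> scale c x \<in> G"
      "\<And>x y. x \<in> G \<Longrightarrow> y \<in> G \<Longrightarrow> bracket x y \<in> G"
  shows "isomorphic_modules G M N"
proof -
  have M: "mcarrier M = \<psi> ` mcarrier N"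
    using bij by (simp add: bij_betw_def)
  have N': "submodule G N (mcarrier N)"
    using N by (simp add: lie_module_def)
  then have cl: "\<And>u v. u \<in> mcarrier N \<Longrightarrow> v \<in> mcarrier N \<Longrightarrow> madd N u v \<in> mcarrier N"
    "\<And>c u. u \<in> mcarrier N \<Longrightarrow> mscale N c u \<in> mcarrier N"
    "\<And>x u. x \<in> G \<Longrightarrow> u \<in> mcarrier N \<Longrightarrow> mact N x u \<in> mcarrier N"
    by (auto simp: submodule_def)
  note hom = add scl act
  have "submodule G M (mcarrier M)"
    using N' by (auto simp: submodule_def M hom cl)
  then have "lie_module G M"
    using N unfolding lie_module_def M by (auto simp: hom cl G)
  moreover have "bij_betw (inv_into (mcarrier N) \<psi>) (mcarrier M) (mcarrier N)"
    using bij by (rule bij_betw_inv_into)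
  moreover have "inv_into (mcarrier N) \<psi> (\<psi> u) = u" if "u \<in> mcarrier N" for u
    using bij that by (simp add: bij_betw_def inv_into_f_f)
  ultimately show ?thesis
    unfolding isomorphic_modules_def using N
    by (intro conjI exI[of _ "inv_into (mcarrier N) \<psi>"]) (auto simp: M hom cl)
qed

end

section \<open>External tensor products of coordinate modules\<close>

lemma coord_module_simps [simp]:
  "mcarrier (coord_module A \<rho>) = A" "mact (coord_module A \<rho>) = \<rho>"
  "madd (coord_module A \<rho>) u v i = u i + v i" "mscale (coord_module A \<rho>) c u i = c * u i"
  by (simp_all add: coord_module_def)

lemma ext_tensor_carrier:
  assumes "finite S" and V: "mcarrier V = {v. \<forall>i. i \<notin> S \<longrightarrow> v i = 0}"
    and W: "mcarrier W = {w. \<forall>j. j \<notin> S' \<longrightarrow> w j = 0}"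
  shows "mcarrier (V \<boxtimes> W) = {T. \<forall>i j. i \<notin> S \<or> j \<notin> S' \<longrightarrow> T (i, j) = 0}"
proof (intro subset_antisym subsetI)
  fix T assume "T \<in> mcarrier (V \<boxtimes> W)"
  then show "T \<in> {T. \<forall>i j. i \<notin> S \<or> j \<notin> S' \<longrightarrow> T (i, j) = 0}"
    by (auto simp: ext_tensor_def tensor_def V W intro!: sum.neutral)
next
  fix T assume T: "T \<in> {T. \<forall>i j. i \<notin> S \<or> j \<notin> S' \<longrightarrow> T (i, j) = (0 :: complex)}"
  obtain e where e: "bij_betw e {..<card S} S"
    using ex_bij_betw_nat_finite[OF \<open>finite S\<close>] by (auto simp: atLeast0LessThan)
  \<comment> \<open>Decomposition into rows: a basis vector of the first factor tensored with the
    corresponding row of \<open>T\<close>; finiteness of \<open>S\<close> bounds the number of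
    summands.\<close>
  define v w where "v k = (\<lambda>i. if i = e k then 1 else 0 :: complex)" and "w k = (\<lambda>j. T (e k, j))"
      for k
  have "(\<Sum>k<card S. (v k \<otimes>\<^sub>v w k) (i, j)) = T (i, j)" for i j
  proof -
    have "(\<Sum>k<card S. (v k \<otimes>\<^sub>v w k) (i, j)) = (\<Sum>k<card S. if i = e k then T (e k, j) else 0)"
      by (auto simp: tensor_def v_def w_def intro!: sum.cong)
    also have "\<dots> = (\<Sum>l\<in>S. if i = l then T (l, j) else 0)"
      by (rule sum.reindex_bij_betw[OF e])
    also have "\<dots> = T (i, j)"
      using T \<open>finite S\<close> by (auto simp: sum.delta')
    finally show ?thesis .
  qed
  then have "T = (\<lambda>ij. \<Sum>k<card S. (v k \<otimes>\<^sub>v w k) ij)"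
    by (auto simp: fun_eq_iff)
  moreover have "v k \<in> mcarrier V \<and> w k \<in> mcarrier W" if "k < card S" for k
    using T bij_betwE[OF e] that by (auto simp: V W v_def w_def)
  ultimately show "T \<in> mcarrier (V \<boxtimes> W)"
    unfolding ext_tensor_def by (auto intro!: exI[of _ "card S"] exI[of _ v] exI[of _ w])
qed

lemma ext_tensor_simps [simp]:
  "madd (V \<boxtimes> W) u v ij = u ij + v ij" "mscale (V \<boxtimes> W) c u ij = c * u ij"
  "mact (V \<boxtimes> W) (x, y) T (i, j) = mact V x (\<lambda>i'. T (i', j)) i + mact W y (\<lambda>j'. T (i, j')) j"
  by (simp_all add: ext_tensor_def)

lemma ext_tensor_ops:
  "madd (V \<boxtimes> W) u v = (\<lambda>ij. u ij + v ij)" "mscale (V \<boxtimes> W) c u = (\<lambda>ij. c * u ij)"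
  by (simp_all add: fun_eq_iff)

lemma coord_lie_moduleD:
  assumes M: "gl2.lie_module G M" and M_def: "M = coord_module A \<rho>"
  shows "\<lbrakk>u \<in> A; v \<in> A\<rbrakk> \<Longrightarrow> (\<lambda>i. u i + v i) \<in> A" and "u \<in> A \<Longrightarrow> (\<lambda>i. c * u i) \<in> A"
    and "\<lbrakk>x \<in> G; u \<in> A\<rbrakk> \<Longrightarrow> \<rho> x u \<in> A"
    and "\<lbrakk>x \<in> G; u \<in> A; v \<in> A\<rbrakk> \<Longrightarrow> \<rho> x (\<lambda>i. u i + v i) = (\<lambda>i. \<rho> x u i + \<rho> x v i)"
    and "\<lbrakk>x \<in> G; u \<in> A\<rbrakk> \<Longrightarrow> \<rho> x (\<lambda>i. c * u i) = (\<lambda>i. c * \<rho> x u i)"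
    and "\<lbrakk>x \<in> G; y \<in> G; u \<in> A\<rbrakk> \<Longrightarrow> \<rho> (x + y) u = (\<lambda>i. \<rho> x u i + \<rho> y u i)"
    and "\<lbrakk>x \<in> G; u \<in> A\<rbrakk> \<Longrightarrow> \<rho> (map_matrix ((*) c) x) u = (\<lambda>i. c * \<rho> x u i)"
    and "\<lbrakk>x \<in> G; y \<in> G; u \<in> A\<rbrakk> \<Longrightarrow> \<rho> (commutator x y) u i + \<rho> y (\<rho> x u) i = \<rho> x (\<rho> y u) i"
proof -
  have c: "mcarrier M = A" "mact M = \<rho>" "\<And>u v. madd M u v = (\<lambda>i. u i + v i)"
      "\<And>c u. mscale M c u = (\<lambda>i. c * u i)"
    by (simp_all add: M_def fun_eq_iff)
  have "\<forall>u\<in>A. \<forall>v\<in>A. (\<lambda>i. u i + v i) \<in> A" and "\<forall>c. \<forall>u\<in>A. (\<lambda>i. c * u i) \<in> A"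
    and "\<forall>x\<in>G. \<forall>u\<in>A. \<rho> x u \<in> A"
    and "\<forall>x\<in>G. \<forall>u\<in>A. \<forall>v\<in>A. \<rho> x (\<lambda>i. u i + v i) = (\<lambda>i. \<rho> x u i + \<rho> x v i)"
    and "\<forall>x\<in>G. \<forall>c. \<forall>u\<in>A. \<rho> x (\<lambda>i. c * u i) = (\<lambda>i. c * \<rho> x u i)"
    and "\<forall>x\<in>G. \<forall>y\<in>G. \<forall>u\<in>A. \<rho> (x + y) u = (\<lambda>i. \<rho> x u i + \<rho> y u i)"
    and "\<forall>x\<in>G. \<forall>c. \<forall>u\<in>A. \<rho> (map_matrix ((*) c) x) u = (\<lambda>i. c * \<rho> x u i)"
    and "\<forall>x\<in>G. \<forall>y\<in>G. \<forall>u\<in>A. (\<lambda>i. \<rho> (commutator x y) u i + \<rho> y (\<rho> x u) i) = \<rho> x (\<rho> y u)"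
    using M[unfolded gl2.lie_module_def submodule_def c] by - (elim conjE, assumption)+
  note M' = this[rule_format]
  show "\<lbrakk>u \<in> A; v \<in> A\<rbrakk> \<Longrightarrow> (\<lambda>i. u i + v i) \<in> A"
    by (rule M'(1))
  show "u \<in> A \<Longrightarrow> (\<lambda>i. c * u i) \<in> A"
    by (rule M'(2))
  show "\<lbrakk>x \<in> G; u \<in> A\<rbrakk> \<Longrightarrow> \<rho> x u \<in> A"
    by (rule M'(3))
  show "\<lbrakk>x \<in> G; u \<in> A; v \<in> A\<rbrakk> \<Longrightarrow> \<rho> x (\<lambda>i. u i + v i) = (\<lambda>i. \<rho> x u i + \<rho> x v i)"
    by (rule M'(4))
  show "\<lbrakk>x \<in> G; u \<in> A\<rbrakk> \<Longrightarrow> \<rho> x (\<lambda>i. c * u i) = (\<lambda>i. c * \<rho> x u i)"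
    by (rule M'(5))
  show "\<lbrakk>x \<in> G; y \<in> G; u \<in> A\<rbrakk> \<Longrightarrow> \<rho> (x + y) u = (\<lambda>i. \<rho> x u i + \<rho> y u i)"
    by (rule M'(6))
  show "\<lbrakk>x \<in> G; u \<in> A\<rbrakk> \<Longrightarrow> \<rho> (map_matrix ((*) c) x) u = (\<lambda>i. c * \<rho> x u i)"
    by (rule M'(7))
  show "\<lbrakk>x \<in> G; y \<in> G; u \<in> A\<rbrakk> \<Longrightarrow> \<rho> (commutator x y) u i + \<rho> y (\<rho> x u) i = \<rho> x (\<rho> y u) i"
    by (rule fun_cong[OF M'(8)])
qed

text \<open>The matrix of a linear map that is known to be linear only on \<open>A\<close>. It
  serves to interchange the abstract actions of two tensor factors, which becomes an exchange of
  finite sums.\<close>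

lemma coord_action_expand:
  assumes lin: "\<And>u v. u \<in> A \<Longrightarrow> v \<in> A \<Longrightarrow> \<rho> (\<lambda>i. u i + v i) = (\<lambda>i. \<rho> u i + \<rho> v i)"
    "\<And>c u. u \<in> A \<Longrightarrow> \<rho> (\<lambda>i. c * u i) = (\<lambda>i. c * \<rho> u i)"
    and "finite S" and A: "A = {v :: 'i \<Rightarrow> complex. \<forall>i. i \<notin> S \<longrightarrow> v i = 0}" and "v \<in> A"
  shows "\<rho> v i = (\<Sum>k\<in>S. v k * \<rho> (\<lambda>l. if l = k then 1 else 0) i)"
proof -
  have "\<rho> (\<lambda>l. if l \<in> S' then v l else 0) i = (\<Sum>k\<in>S'. v k * \<rho> (\<lambda>l. if l = k then 1 else 0) i)"
    if "S' \<subseteq> S" for S'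
    using finite_subset[OF that \<open>finite S\<close>] that
  proof (induction S')
    case empty
    show ?case using lin(2)[of "\<lambda>_. 0" 0] by (auto simp: A fun_eq_iff)
  next
    case (insert k S')
    have "(\<lambda>l. if l \<in> insert k S' then v l else 0) =
        (\<lambda>l. v k * (if l = k then 1 else 0) + (if l \<in> S' then v l else 0))"
      using insert by (auto simp: fun_eq_iff)
    moreover have "(\<lambda>l. v k * (if l = k then 1 else 0)) \<in> A" "(\<lambda>l. if l = k then 1 else 0) \<in> A"
      "(\<lambda>l. if l \<in> S' then v l else 0) \<in> A"
      using insert by (auto simp: A)
    ultimately show ?case
      using insert by (simp add: lin)
  qed
  moreover have "(\<lambda>l. if l \<in> S then v l else 0) = v"
    using \<open>v \<in> A\<close> by (auto simp: A)
  ultimately show ?thesis by fastforce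
qed

text \<open>Beyond the axioms of the two factors, the point is that their actions concern different
  indices and therefore commute.\<close>

lemma lie_module_ext_tensor:
  assumes V: "gl2.lie_module G V" "V = coord_module {v. \<forall>i. i \<notin> S \<longrightarrow> v i = 0} \<rho>" "finite S"
    and W: "gl2.lie_module H W" "W = coord_module {w. \<forall>j. j \<notin> S' \<longrightarrow> w j = 0} \<sigma>" "finite S'"
  shows "gl2_gl2.lie_module (G \<times> H) (V \<boxtimes> W)"
proof -
  define A B where "A = {v :: 'a \<Rightarrow> complex. \<forall>i. i \<notin> S \<longrightarrow> v i = 0}"
    and "B = {w :: 'b \<Rightarrow> complex. \<forall>j. j \<notin> S' \<longrightarrow> w j = 0}"
  note V' = V(2)[folded A_def] and W' = W(2)[folded B_def]
  note \<rho> = coord_lie_moduleD[OF V(1) V'] and \<sigma> = coord_lie_moduleD[OF W(1) W']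
  define C where "C = {T :: 'a \<times> 'b \<Rightarrow> complex. \<forall>i j. i \<notin> S \<or> j \<notin> S' \<longrightarrow> T (i, j) = 0}"
  have carrier: "mcarrier (V \<boxtimes> W) = C"
    unfolding C_def by (rule ext_tensor_carrier) (simp_all add: V W)
  have slice: "(\<lambda>i. T (i, j)) \<in> A" "(\<lambda>j. T (i, j)) \<in> B" if "T \<in> C" for T i j
    using that by (auto simp: A_def B_def C_def)
  have act: "mact (V \<boxtimes> W) (x, y) T = (\<lambda>(i, j). \<rho> x (\<lambda>i'. T (i', j)) i + \<sigma> y (\<lambda>j'. T (i, j')) j)"
      for x y T
    by (simp add: fun_eq_iff V' W')
  have zero: "\<rho> x (\<lambda>_. 0) i = 0" if "x \<in> G" for x i
    using \<rho>(5)[OF that, of "\<lambda>_. 0" 0] by (simp add: A_def)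
  have zero': "\<sigma> y (\<lambda>_. 0) j = 0" if "y \<in> H" for y j
    using \<sigma>(5)[OF that, of "\<lambda>_. 0" 0] by (simp add: B_def)
  \<comment> \<open>For an index outside the support, either the action preserves the support in
    that index or the whole slice is zero.\<close>
  have outside: "\<rho> x (\<lambda>i'. T (i', j)) i = 0" "\<sigma> y (\<lambda>j'. T (i, j')) j = 0"
    if "x \<in> G" "y \<in> H" "T \<in> C" "i \<notin> S \<or> j \<notin> S'" for x y T i j
  proof -
    have "\<rho> x (\<lambda>i'. T (i', j)) \<in> A" "\<sigma> y (\<lambda>j'. T (i, j')) \<in> B"
      using that by (auto intro!: \<rho>(3) \<sigma>(3) slice)
    moreover have "(\<lambda>i'. T (i', j)) = (\<lambda>_. 0)" if "j \<notin> S'"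
      using that \<open>T \<in> C\<close> by (auto simp: C_def)
    moreover have "(\<lambda>j'. T (i, j')) = (\<lambda>_. 0)" if "i \<notin> S"
      using that \<open>T \<in> C\<close> by (auto simp: C_def)
    ultimately show "\<rho> x (\<lambda>i'. T (i', j)) i = 0" "\<sigma> y (\<lambda>j'. T (i, j')) j = 0"
      using that zero zero' by (auto simp: A_def B_def)
  qed
  have closed: "(\<lambda>(i, j). \<rho> x (\<lambda>i'. T (i', j)) i) \<in> C" "(\<lambda>(i, j). \<sigma> y (\<lambda>j'. T (i, j')) j) \<in> C"
    if "x \<in> G" "y \<in> H" "T \<in> C" for x y T
    using outside[OF that] by (auto simp: C_def)
  have comm: "\<rho> x (\<lambda>i'. \<sigma> y (\<lambda>j'. T (i', j')) j) i = \<sigma> y (\<lambda>j'. \<rho> x (\<lambda>i'. T (i', j')) i) j"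
    if "x \<in> G" "y \<in> H" "T \<in> C" for x y T i j
  proof -
    have \<rho>x: "\<rho> x v i = (\<Sum>k\<in>S. v k * \<rho> x (\<lambda>l. if l = k then 1 else 0) i)" if "v \<in> A" for v i
      by (rule coord_action_expand[OF \<rho>(4,5) \<open>finite S\<close> A_def that]) (rule \<open>x \<in> G\<close> | assumption)+
    have \<sigma>y: "\<sigma> y w j = (\<Sum>k\<in>S'. w k * \<sigma> y (\<lambda>l. if l = k then 1 else 0) j)" if "w \<in> B" for w j
      by (rule coord_action_expand[OF \<sigma>(4,5) \<open>finite S'\<close> B_def that]) (rule \<open>y \<in> H\<close> | assumption)+
    have "\<rho> x (\<lambda>i'. \<sigma> y (\<lambda>j'. T (i', j')) j) i =
        (\<Sum>k\<in>S. \<Sum>l\<in>S'. T (k, l) * \<sigma> y (\<lambda>m. if m = l then 1 else 0) j * \<rho> x (\<lambda>m.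
            if m = k then 1 else 0) i)"
      using slice(1)[OF closed(2)[OF that], of j] slice(2)[OF that(3)]
      by (simp add: \<rho>x \<sigma>y sum_distrib_right)
    also have "\<dots> = (\<Sum>l\<in>S'. \<Sum>k\<in>S. T (k, l) * \<rho> x (\<lambda>m. if m = k then 1 else 0) i * \<sigma> y (\<lambda>m.
        if m = l then 1 else 0) j)"
      by (subst sum.swap) (simp add: ac_simps)
    also have "\<dots> = \<sigma> y (\<lambda>j'. \<rho> x (\<lambda>i'. T (i', j')) i) j"
      using slice(2)[OF closed(1)[OF that], of i] slice(1)[OF that(3)]
      by (simp add: \<rho>x \<sigma>y sum_distrib_right)
    finally show ?thesis .
  qed
  have "submodule (G \<times> H) (V \<boxtimes> W) C"
    unfolding submodule_def carrier using closed
    by (auto simp: ext_tensor_ops act C_def outside intro!: exI[of _ "\<lambda>_. 0"])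
  moreover have "mact (V \<boxtimes> W) (commutator x x', commutator y y') T (i, j) +
      mact (V \<boxtimes> W) (x', y') (mact (V \<boxtimes> W) (x, y) T) (i, j) = mact (V \<boxtimes> W) (x, y) (mact (V \<boxtimes> W) (x',
          y') T) (i, j)"
    if x: "x \<in> G" "x' \<in> G" and y: "y \<in> H" "y' \<in> H" and T: "T \<in> C" for x x' y y' T i j
  proof -
    \<comment> \<open>After expansion the mixed terms on both sides of the bracket identity agree by
      \<open>comm\<close>, and the pure terms are the identities of the factors.\<close>
    have expand: "mact (V \<boxtimes> W) (s', t') (mact (V \<boxtimes> W) (s, t) T) (i, j) =
        \<rho> s' (\<rho> s (\<lambda>i'. T (i', j))) i + \<rho> s' (\<lambda>i'. \<sigma> t (\<lambda>j'. T (i', j')) j) i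
        + (\<sigma> t' (\<lambda>j'. \<rho> s (\<lambda>i'. T (i', j')) i) j + \<sigma> t' (\<sigma> t (\<lambda>j'. T (i, j'))) j)"
      if "s \<in> G" "s' \<in> G" "t \<in> H" "t' \<in> H" for s s' t t'
    proof -
      have "\<rho> s (\<lambda>i'. T (i', j)) \<in> A" "(\<lambda>i'. \<sigma> t (\<lambda>j'. T (i', j')) j) \<in> A"
        using slice(1)[OF closed(2)[OF that(1,3) T], of j] \<rho>(3)[OF that(1) slice(1)[OF T]] by auto
      moreover have "(\<lambda>j'. \<rho> s (\<lambda>i'. T (i', j')) i) \<in> B" "\<sigma> t (\<lambda>j'. T (i, j')) \<in> B"
        using slice(2)[OF closed(1)[OF that(1,3) T], of i] \<sigma>(3)[OF that(3) slice(2)[OF T]] by auto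
      ultimately show ?thesis
        by (simp add: act \<rho>(4) \<sigma>(4) that)
    qed
    show ?thesis
      unfolding expand[OF x y] expand[OF x(2,1) y(2,1)]
      using \<rho>(8)[OF x slice(1)[OF T], of j i] \<sigma>(8)[OF y slice(2)[OF T], of i j]
      by (simp add: act comm x y T algebra_simps)
  qed
  then have "\<forall>x\<in>G \<times> H. \<forall>y\<in>G \<times> H. \<forall>u\<in>C. madd (V \<boxtimes> W)
     (mact (V \<boxtimes> W) ((\<lambda>(x, y) (x', y'). (commutator x x', commutator y y')) x y) u)
     (mact (V \<boxtimes> W) y (mact (V \<boxtimes> W) x u)) = mact (V \<boxtimes> W) x (mact (V \<boxtimes> W) y u)"
    by (auto simp: fun_eq_iff)
  ultimately show ?thesis
    unfolding gl2_gl2.lie_module_def carrier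
    by (auto simp: ext_tensor_ops act fun_eq_iff \<rho>(4-7) \<sigma>(4-7) slice algebra_simps)
qed

lemma lie_module_direct_sum:
  assumes "gl2_gl2.lie_module G M" "gl2_gl2.lie_module G N"
  shows "gl2_gl2.lie_module G (M \<oplus>\<^sub>m N)"
  using assms unfolding gl2_gl2.lie_module_def submodule_def
  by (auto simp: direct_sum_def)

lemma lie_module_trivial_module: "gl2.lie_module G trivial_module"
  by (auto simp: gl2.lie_module_def submodule_def trivial_module_def coord_module_def fun_eq_iff
      algebra_simps)

section \<open>Bilinear forms on polynomials\<close>

definition bilinear_form :: "(complex poly \<Rightarrow> complex poly \<Rightarrow> complex) \<Rightarrow> bool" where
  "bilinear_form W \<longleftrightarrow> (\<forall>p q r. W (p + q) r = W p r + W q r \<and> W r (p + q) = W r p + W r q) \<and>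
     (\<forall>c p q. W (smult c p) q = c * W p q \<and> W p (smult c q) = c * W p q)"

lemma bilinear_formD:
  assumes "bilinear_form W"
  shows "W (p + q) r = W p r + W q r" "W r (p + q) = W r p + W r q"
    "W (smult c p) q = c * W p q" "W p (smult c q) = c * W p q"
    "W 0 q = 0" "W q 0 = 0" "W (- p) q = - W p q" "W p (- q) = - W p q"
    "W (p - q) r = W p r - W q r" "W r (p - q) = W r p - W r q"
proof -
  show *: "W (p + q) r = W p r + W q r" "W r (p + q) = W r p + W r q"
    "W (smult c p) q = c * W p q" "W p (smult c q) = c * W p q" for p q r c
    using assms by (auto simp: bilinear_form_def)
  show "W 0 q = 0" "W q 0 = 0" using *(3)[of 0 0 q] *(4)[of q 0 0] by auto
  show **: "W (- p) q = - W p q" "W p (- q) = - W p q" for p q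
    using *(3)[of "- 1" p q] *(4)[of p "- 1" q] by auto
  show "W (p - q) r = W p r - W q r" "W r (p - q) = W r p - W r q"
    using *(1)[of p "- q" r] *(2)[of r p "- q"] ** by auto
qed

lemma bilinear_form_lincomb:
  "\<lbrakk>bilinear_form V; bilinear_form W\<rbrakk> \<Longrightarrow> bilinear_form (\<lambda>u v. c * V u v + d * W u v)"
  by (simp add: bilinear_form_def algebra_simps)

lemma bilinear_form_flip: "bilinear_form V \<Longrightarrow> bilinear_form (\<lambda>u v. V v u)"
  by (simp add: bilinear_form_def)

definition linear_form :: "(complex poly \<Rightarrow> complex) \<Rightarrow> bool" where
  "linear_form \<phi> \<longleftrightarrow> (\<forall>p q. \<phi> (p + q) = \<phi> p + \<phi> q) \<and> (\<forall>c p. \<phi> (smult c p) = c * \<phi> p)"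

lemma linear_formD:
  assumes "linear_form \<phi>"
  shows "\<phi> (p + q) = \<phi> p + \<phi> q" "\<phi> (smult c p) = c * \<phi> p" "\<phi> 0 = 0" "\<phi> (- p) = - \<phi> p"
    "\<phi> (p - q) = \<phi> p - \<phi> q"
proof -
  show *: "\<phi> (p + q) = \<phi> p + \<phi> q" "\<phi> (smult c p) = c * \<phi> p" for p q c
    using assms by (auto simp: linear_form_def)
  show "\<phi> 0 = 0" using *(2)[of 0 0] by auto
  show **: "\<phi> (- p) = - \<phi> p" for p using *(2)[of "- 1" p] by auto
  show "\<phi> (p - q) = \<phi> p - \<phi> q" using *(1)[of p "- q"] ** by auto
qed

lemma poly_induct_power [case_names zero add power]:
  fixes p :: "complex poly"
  assumes zero: "P 0" and add: "\<And>p q. P p \<Longrightarrow> P q \<Longrightarrow> P (p + q)"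
    and power: "\<And>c n. P (smult c ([:0, 1:] ^ n))"
  shows "P p"
proof -
  have "P (monom c n)" for c n
    using power by (simp only: monom_altdef)
  then have "P (\<Sum>i\<le>n. monom (coeff p i) i)" for n
    by (induction n) (auto intro: add)
  from this[of "degree p"] show ?thesis by (simp add: poly_as_sum_of_monoms)
qed

lemma ex_antiderivative: "\<exists>P :: complex poly. pderiv P = p"
proof (induction p rule: poly_induct_power)
  case zero
  show ?case by (rule exI[of _ 0]) simp
next
  case (add p q)
  then show ?case by (metis pderiv_add)
next
  case (power c n)
  have "pderiv (smult (c / of_nat (Suc n)) ([:0, 1:] ^ Suc n)) = smult c ([:0, 1:] ^ n)"
    by (simp add: pderiv_smult pderiv_power_Suc pderiv_pCons del: of_nat_Suc power_Suc)
  then show ?case by blast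
qed

text \<open>
  The integral from \<open>a\<close> to \<open>b\<close>; antiderivatives of polynomials differ by constants, so the
  choice is harmless.
\<close>

definition poly_period :: "complex \<Rightarrow> complex \<Rightarrow> complex poly \<Rightarrow> complex" where
  "poly_period a b p = (let P = SOME P. pderiv P = p in poly P b - poly P a)"

lemma poly_period_pderiv: "poly_period a b (pderiv P) = poly P b - poly P a"
proof -
  define Q where "Q = (SOME Q. pderiv Q = pderiv P)"
  have "pderiv Q = pderiv P"
    unfolding Q_def by (rule someI[of _ P]) simp
  then have "pderiv (Q - P) = 0"
    by (simp add: pderiv_diff)
  then obtain h where "Q - P = [:h:]"
    using pderiv_iszero by blast
  then have "Q = P + [:h:]"
    by (simp add: algebra_simps)
  then show ?thesis
    by (simp add: poly_period_def flip: Q_def)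
qed

lemma linear_form_poly_period: "linear_form (poly_period a b)"
  unfolding linear_form_def
proof (intro conjI allI)
  fix p q :: "complex poly" and c
  obtain P Q where [simp]: "p = pderiv P" "q = pderiv Q"
    using ex_antiderivative by metis
  show "poly_period a b (p + q) = poly_period a b p + poly_period a b q"
    by (simp add: poly_period_pderiv flip: pderiv_add)
  show "poly_period a b (smult c p) = c * poly_period a b p"
    by (simp add: poly_period_pderiv algebra_simps flip: pderiv_smult)
qed

text \<open>The Wronskian of the two polynomials, evaluated at \<open>c\<close>.\<close>

definition jet_form :: "complex \<Rightarrow> complex poly \<Rightarrow> complex poly \<Rightarrow> complex" where
  "jet_form c u v = poly u c * poly (pderiv v) c - poly (pderiv u) c * poly v c"

lemma bilinear_jet_form: "bilinear_form (jet_form c)"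
  by (simp add: bilinear_form_def jet_form_def pderiv_add pderiv_smult algebra_simps)

section \<open>Forms on polynomials that are controlled on multiples of \<open>f\<close>\<close>

locale two_points =
  fixes a b :: complex
  assumes neq: "a \<noteq> b"
begin

definition f :: "complex poly" where
  "f = [:- a, 1:] * [:- b, 1:]"

lemma poly_f [simp]: "poly f a = 0" "poly f b = 0"
  "poly (pderiv f) a = a - b" "poly (pderiv f) b = b - a" "pderiv (pderiv f) = [:2:]"
  by (simp_all add: f_def pderiv_mult pderiv_pCons pderiv_add)

lemma f_neq_0: "f \<noteq> 0"
  by (simp add: f_def)

lemma f_dvd_iff: "f dvd p \<longleftrightarrow> poly p a = 0 \<and> poly p b = 0"
proof
  assume "poly p a = 0 \<and> poly p b = 0"
  then have "[:- a, 1:] dvd p" "poly p b = 0"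
    by (simp_all add: poly_eq_0_iff_dvd)
  then obtain q where q: "p = [:- a, 1:] * q" and "poly p b = 0"
    by (elim dvdE)
  then have "poly q b = 0" using neq by auto
  then show "f dvd p"
    unfolding q f_def poly_eq_0_iff_dvd by (rule mult_dvd_mono[OF dvd_refl])
next
  assume "f dvd p"
  then show "poly p a = 0 \<and> poly p b = 0"
    by (elim dvdE) simp
qed

text \<open>Lagrange interpolation at the two roots: the remainder modulo \<open>f\<close> is fixed
  by the values at \<open>a\<close> and \<open>b\<close>.\<close>

lemma mod_f_decomposition:
  obtains r where "u = smult (poly u a / (a - b)) [:- b, 1:] + smult (poly u b / (b - a)) [:- a, 1:]
      + f * r"
proof -
  have "f dvd u - (smult (poly u a / (a - b)) [:- b, 1:] + smult (poly u b / (b - a)) [:- a, 1:])"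
    using neq by (simp add: f_dvd_iff divide_simps) (simp add: algebra_simps)
  then obtain r where "u - (smult (poly u a / (a - b)) [:- b, 1:] + smult (poly u b / (b
      - a)) [:- a, 1:]) = f * r"
    by (elim dvdE)
  then show ?thesis by (intro that[of r]) (metis add.commute diff_add_cancel)
qed

lemma linear_form_mod_f:
  assumes "linear_form \<phi>" "\<And>u. \<phi> (f * u) = 0"
  obtains x y where "\<And>u. \<phi> u = x * poly u a + y * poly u b"
proof
  fix u
  obtain r where "u = smult (poly u a / (a - b)) [:- b, 1:] + smult (poly u b / (b - a)) [:- a, 1:]
      + f * r"
    by (rule mod_f_decomposition)
  then have "\<phi> u = \<phi> (smult (poly u a / (a - b)) [:- b, 1:] + smult (poly u b / (b - a)) [:- a, 1:]
      + f * r)"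
    by (rule arg_cong)
  then show "\<phi> u = \<phi> [:- b, 1:] / (a - b) * poly u a + \<phi> [:- a, 1:] / (b - a) * poly u b"
    by (simp only: linear_formD[OF assms(1)] assms(2)) (simp add: mult.commute)
qed

lemma bilinear_form_mod_f:
  assumes W: "bilinear_form W" and W0: "\<And>u v. W (f * u) v = 0" "\<And>u v. W u (f * v) = 0"
  obtains x y z w where "\<And>u v. W u v = x * (poly u a * poly v a) + y * (poly u a * poly v b)
    + z * (poly u b * poly v a) + w * (poly u b * poly v b)"
proof -
  have lin: "linear_form (\<lambda>u. W u v)" "linear_form (W v)" for v
    by (simp_all add: linear_form_def bilinear_formD[OF W])
  have "\<exists>x y. \<forall>v. W u v = x * poly v a + y * poly v b" for u
    by (rule linear_form_mod_f[OF lin(2)[of u] W0(2)]) blast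
  then obtain X Y where XY: "\<And>u v. W u v = X u * poly v a + Y u * poly v b"
    by metis
  have "\<exists>x y. \<forall>u. W u v = x * poly u a + y * poly u b" for v
    by (rule linear_form_mod_f[OF lin(1)[of v] W0(1)]) blast
  then obtain X' Y' where XY': "\<And>u v. W u v = X' v * poly u a + Y' v * poly u b"
    by metis
  \<comment> \<open>The polynomial \<open>[:- b, 1:]\<close> vanishes at \<open>b\<close> and equals
    \<open>a - b\<close> at \<open>a\<close>, so inserting it isolates \<open>X\<close>; the other
    linear factor isolates \<open>Y\<close>.\<close>
  have X: "X u = (X' [:- b, 1:] * poly u a + Y' [:- b, 1:] * poly u b) / (a - b)" for u
    using neq XY[of u "[:- b, 1:]"] XY'[of u "[:- b, 1:]"] by (simp add: field_simps)
  have Y: "Y u = (X' [:- a, 1:] * poly u a + Y' [:- a, 1:] * poly u b) / (b - a)" for u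
    using neq XY[of u "[:- a, 1:]"] XY'[of u "[:- a, 1:]"] by (simp add: field_simps)
  show ?thesis
  proof
    fix u v
    show "W u v = X' [:- b, 1:] / (a - b) * (poly u a * poly v a) + X' [:- a, 1:] / (b
        - a) * (poly u a * poly v b)
      + Y' [:- b, 1:] / (a - b) * (poly u b * poly v a) + Y' [:- a, 1:] / (b
          - a) * (poly u b * poly v b)"
      unfolding XY[of u v] X Y by (simp add: algebra_simps add_divide_distrib)
  qed
qed

definition cross_form :: "complex poly \<Rightarrow> complex poly \<Rightarrow> complex" where
  "cross_form u v = poly u a * poly v b - poly u b * poly v a"

text \<open>The form lives on the two-dimensional quotient by \<open>f\<close>, where skew forms
  make up a line.\<close>

lemma skew_form_mod_f:
  assumes W: "bilinear_form W" and W0: "\<And>u v. W (f * u) v = 0" and skew: "\<And>u v. W u v = - W v u"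
  obtains z where "\<And>u v. W u v = z * cross_form u v"
proof -
  have "W u (f * v) = 0" for u v
    using skew[of u "f * v"] W0 by simp
  with W W0 obtain x y z w where xyzw: "\<And>u v. W u v = x * (poly u a * poly v a)
    + y * (poly u a * poly v b) + z * (poly u b * poly v a) + w * (poly u b * poly v b)"
    using bilinear_form_mod_f by blast
  show ?thesis
  proof
    fix u v
    have "W u v = (W u v - W v u) / 2"
      using skew[of v u] by simp
    then show "W u v = (y - z) / 2 * cross_form u v"
      by (simp add: xyzw cross_form_def field_simps)
  qed
qed

text \<open>Total symmetry reduces \<open>C (f * u) w\<close> to one functional of
  \<open>u * w\<close>; skewness forces that functional to vanish on multiples of \<open>f\<close>,
  so it is a combination of evaluations, which the jet forms reproduce.\<close>

lemma skew_form_totally_symmetric_on_f: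
  assumes C: "bilinear_form C" and skew: "\<And>u v. C u v = - C v u"
    and cyc: "\<And>u v w. C (f * (u * v)) w = C (f * (v * w)) u"
  obtains x y z where "\<And>u v. C u v = x * jet_form a u v + y * jet_form b u v + z * cross_form u v"
proof -
  define \<tau> where "\<tau> g = C (f * g) 1" for g
  have \<tau>: "C (f * u) w = \<tau> (u * w)" for u w
    using cyc[of u 1 w] cyc[of 1 w u] by (simp add: \<tau>_def mult.commute)
  have "linear_form \<tau>"
    by (simp add: linear_form_def \<tau>_def bilinear_formD[OF C] distrib_left)
  \<comment> \<open>Both orders of the arguments \<open>f * u\<close> and \<open>f\<close> give the
    same value of \<tau>, while skewness makes them opposite.\<close>
  moreover have "\<tau> (f * u) = 0" for u
    using \<tau>[of u f] \<tau>[of 1 "f * u"] skew[of "f * u" "f * 1"] by (simp add: mult.commute)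
  ultimately obtain x y where xy: "\<And>u. \<tau> u = x * poly u a + y * poly u b"
    by (rule linear_form_mod_f) blast
  \<comment> \<open>At a multiple of \<open>f\<close> in the first argument the jet form sees only
    the derivative of \<open>f\<close>, which is \<open>a - b\<close> at \<open>a\<close> and
    \<open>b - a\<close> at \<open>b\<close>; the coefficients cancel \<tau> there.\<close>
  define C' where "C' u v = C u v + (x / (a - b) * jet_form a u v + y / (b - a) * jet_form b u v)"
      for u v
  have "bilinear_form C'"
    unfolding C'_def
    using bilinear_form_lincomb[OF C bilinear_form_lincomb[OF bilinear_jet_form[of a]
      bilinear_jet_form[of b], of "x / (a - b)" "y / (b - a)"], of 1 1]
    by simp
  moreover have "C' (f * u) v = 0" for u v
  proof -
    have "jet_form a (f * u) v = - (a - b) * (poly u a * poly v a)"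
      "jet_form b (f * u) v = - (b - a) * (poly u b * poly v b)"
      by (simp_all add: jet_form_def pderiv_mult algebra_simps)
    then show ?thesis
      using neq by (simp add: C'_def \<tau> xy divide_simps) (simp add: algebra_simps)
  qed
  moreover have "C' u v = - C' v u" for u v
    using skew[of u v] by (simp add: C'_def jet_form_def algebra_simps)
  ultimately obtain z where z: "\<And>u v. C' u v = z * cross_form u v"
    using skew_form_mod_f by blast
  show ?thesis
    by (rule that[of "- (x / (a - b))" "- (y / (b - a))" z])
      (simp add: z[symmetric] C'_def)
qed

text \<open>Subtracting \<open>B 1 (u * v)\<close> leaves a form modulo \<open>f\<close>. Its two
  diagonal terms depend on \<open>u * v\<close> alone and are absorbed into \<phi>.\<close>

lemma symmetric_form_totally_symmetric_on_f:
  assumes B: "bilinear_form B" and sym: "\<And>u v. B u v = B v u"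
    and cyc: "\<And>u v w. B (f * (u * v)) w = B (f * (v * w)) u"
  obtains \<phi> z where "linear_form \<phi>"
    "\<And>u v. B u v = \<phi> (u * v) + z * (poly u a * poly v b + poly u b * poly v a)"
proof -
  define \<beta> where "\<beta> g = B 1 g" for g
  have \<beta>: "B (f * u) w = \<beta> (f * (u * w))" for u w
    using cyc[of u 1 w] cyc[of 1 w u] sym[of "f * (w * u)" 1] by (simp add: \<beta>_def mult.commute)
  have lin: "linear_form \<beta>"
    by (simp add: linear_form_def \<beta>_def bilinear_formD[OF B])
  define B' where "B' u v = B u v - \<beta> (u * v)" for u v
  have "bilinear_form B'"
    using B by (simp add: bilinear_form_def B'_def linear_formD[OF lin] algebra_simps)
  moreover have "B' (f * u) v = 0" for u v
    by (simp add: B'_def \<beta> mult.assoc)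
  moreover have B'_sym: "B' u v = B' v u" for u v
    using sym[of u v] by (simp add: B'_def mult.commute)
  moreover have "B' u (f * v) = 0" for u v
    using B'_sym[of u "f * v"] \<open>B' (f * v) u = 0\<close> by simp
  ultimately obtain x y z w where xyzw: "\<And>u v. B' u v = x * (poly u a * poly v a)
    + y * (poly u a * poly v b) + z * (poly u b * poly v a) + w * (poly u b * poly v b)"
    using bilinear_form_mod_f by blast
  show ?thesis
  proof
    show "linear_form (\<lambda>g. \<beta> g + x * poly g a + w * poly g b)"
      by (simp add: linear_form_def linear_formD[OF lin] algebra_simps)
    fix u v
    have "B u v = \<beta> (u * v) + (B' u v + B' v u) / 2"
      by (simp add: B'_sym[of v u]) (simp add: B'_def)
    then show "B u v = \<beta> (u * v) + x * poly (u * v) a + w * poly (u * v) b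
        + (y + z) / 2 * (poly u a * poly v b + poly u b * poly v a)"
      by (simp add: xyzw field_simps)
  qed
qed

section \<open>The period form and the classification of cyclic skew forms\<close>

definition period_form :: "complex poly \<Rightarrow> complex poly \<Rightarrow> complex" where
  "period_form u v = poly_period a b (f * u * pderiv (f * v))"

lemma bilinear_period_form: "bilinear_form period_form"
  by (simp add: bilinear_form_def period_form_def linear_formD[OF linear_form_poly_period]
      pderiv_add pderiv_smult algebra_simps)

text \<open>Integration by parts; the boundary terms vanish because \<open>f\<close> does at both
  ends.\<close>

lemma period_form_skew: "period_form u v = - period_form v u"
proof -
  have "period_form u v + period_form v u = poly_period a b (pderiv (f * u * (f * v)))"
    by (simp only: period_form_def pderiv_mult[of "f * u"
        "f * v"] linear_formD[OF linear_form_poly_period])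
  then show ?thesis
    by (simp add: poly_period_pderiv eq_neg_iff_add_eq_0)
qed

text \<open>The three integrands add up to the derivative of the product of \<open>f * u\<close>,
  \<open>f * v\<close> and \<open>f * w\<close>, which vanishes at both ends.\<close>

lemma period_form_cyclic:
  "period_form (f * (u * v)) w + period_form (f * (v * w)) u + period_form (f * (w * u)) v = 0"
proof -
  have "f * (f * (u * v)) * pderiv (f * w) + f * (f * (v * w)) * pderiv (f * u)
      + f * (f * (w * u)) * pderiv (f * v) = pderiv ((f * u) * ((f * v) * (f * w)))"
    unfolding pderiv_mult[of "f * u"] pderiv_mult[of "f * v" "f * w"] by (simp add: algebra_simps)
  then show ?thesis
    by (simp add: period_form_def poly_period_pderiv flip: linear_formD(1)[OF
        linear_form_poly_period])
qed

lemma poly_period_f_cubed: "poly_period a b (f ^ 3) \<noteq> 0"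
proof -
  define A B where "A = [:- a, 1:]" and "B = [:- b, 1:]"
  have [simp]: "pderiv A = 1" "pderiv B = 1" "poly A a = 0" "poly B b = 0" "poly A b = b - a"
    by (simp_all add: A_def B_def pderiv_pCons one_pCons)
  \<comment> \<open>Repeated integration by parts of \<open>A ^ 3 * B ^ 3\<close>, with the
    denominators cleared by 140. Only the last term survives at \<open>b\<close>, and none at
    \<open>a\<close>.\<close>
  define Q where "Q = 35 * A ^ 4 * B ^ 3 - 21 * A ^ 5 * B ^ 2 + 7 * A ^ 6 * B - A ^ 7"
  define P where "P = smult (1 / 140) Q"
  have "pderiv Q = 140 * (A ^ 3 * B ^ 3)"
    by (simp add: Q_def pderiv_add pderiv_diff pderiv_mult pderiv_power eval_nat_numeral
        algebra_simps)
  then have "pderiv P = A ^ 3 * B ^ 3"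
    by (simp add: P_def pderiv_smult numeral_poly)
  moreover have "f = A * B"
    by (simp only: f_def A_def B_def)
  ultimately have "poly_period a b (f ^ 3) = poly P b - poly P a"
    using poly_period_pderiv[of a b P] by (simp add: power_mult_distrib)
  also have "\<dots> = - ((b - a) ^ 7 / 140)"
    by (simp add: P_def Q_def)
  finally show ?thesis using neq by simp
qed

text \<open>The derivative of \<open>f ^ 3 * [:0, 1:]\<close> has period zero, which expresses this
  value through the period of \<open>f ^ 3\<close>. The pair of arguments normalises cyclic forms
  below and later detects the trivial summand.\<close>

lemma period_form_f_t_1: "period_form (f * [:0, 1:]) 1 \<noteq> 0"
proof -
  let ?X = "f * (f * [:0, 1:]) * pderiv f"
  have "pderiv (f ^ 3 * [:0, 1:]) = f ^ 3 + (?X + ?X + ?X)"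
    by (simp only: power3_eq_cube pderiv_mult) (simp add: pderiv_pCons one_pCons algebra_simps)
  then have "poly_period a b (f ^ 3) + 3 * period_form (f * [:0, 1:]) 1
      = poly_period a b (pderiv (f ^ 3 * [:0, 1:]))"
    by (simp only: period_form_def linear_formD[OF linear_form_poly_period] mult_1_right) simp
  also have "\<dots> = 0"
    by (simp add: poly_period_pderiv)
  finally show ?thesis using poly_period_f_cubed by auto
qed

text \<open>
  Up to a correction, \<open>A (f u)\<close> is a derivation, hence \<open>\<phi> (u w')\<close> for a functional \<open>\<phi>\<close>; skewness
  on \<open>f\<close>-multiples gives \<open>\<phi> (4 u f' + u' f) = 0\<close>, a recursion for the moments of \<open>\<phi>\<close> that starts
  at \<open>\<phi> 1 = 0\<close>.
\<close>

lemma normalized_cyclic_skew_form: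
  assumes A: "bilinear_form A" and skew: "\<And>u v. A u v = - A v u"
    and cyc: "\<And>u v w. A (f * (u * v)) w + A (f * (v * w)) u + A (f * (w * u)) v = 0"
    and normalized: "A (f * [:0, 1:]) 1 = 0"
  obtains z where "\<And>u v. A u v = z * cross_form u v"
proof -
  let ?t = "[:0, 1:] :: complex poly"
  define l where "l u w = A (f * u) w" for u w
  define \<gamma> where "\<gamma> g = A (f * g) 1" for g
  \<comment> \<open>Subtracting \<gamma> is the correction that turns the cyclic identity, combined
    with \<open>l_flip\<close>, into the Leibniz rule \<open>D_mult\<close>.\<close>
  define D where "D u w = l u w - \<gamma> (u * w)" for u w
  define \<phi> where "\<phi> g = D g ?t" for g
  have l_flip: "l u w + l w u = - \<gamma> (u * w)" for u w
    using cyc[of u 1 w] by (simp add: l_def \<gamma>_def eq_neg_iff_add_eq_0 mult.commute)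
  have l_f: "l u (f * w) = - l w (f * u)" for u w
    unfolding l_def by (rule skew)
  have D_mult: "D u (v * w) = D (u * v) w + D (u * w) v" for u v w
    using cyc[of u v w] l_flip[of u "v * w"]
    by (simp add: D_def l_def mult.commute mult.left_commute mult.assoc algebra_simps)
      (metis add.commute add.left_commute eq_neg_iff_add_eq_0)
  have D_add: "D (u + v) w = D u w + D v w" "D u (v + w) = D u v + D u w"
    "D (smult c u) w = c * D u w" "D u (smult c w) = c * D u w" for u v w c
    by (simp_all add: D_def l_def \<gamma>_def bilinear_formD[OF A] algebra_simps)
  have lin: "linear_form \<phi>"
    by (simp add: linear_form_def \<phi>_def D_add)
  have D_1: "D u 1 = 0" for u
    using D_mult[of u 1 1] by simp
  \<comment> \<open>A derivation on polynomials is determined by its value at the variable.\<close>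
  have D_eq: "D u w = \<phi> (u * pderiv w)" for u w
  proof (induction w arbitrary: u)
    case 0
    show ?case using D_add(4)[of u 0 0] linear_formD(3)[OF lin] by simp
  next
    case (pCons c w)
    have "D u (pCons c w) = D u (smult c 1 + ?t * w)"
      by (simp add: one_pCons)
    also have "\<dots> = D (u * ?t) w + D (u * w) ?t"
      by (simp only: D_add D_1 D_mult) simp
    also have "\<dots> = \<phi> (u * ?t * pderiv w) + \<phi> (u * w)"
      by (simp only: pCons.IH \<phi>_def)
    also have "\<dots> = \<phi> (u * pderiv (pCons c w))"
      by (simp add: pderiv_pCons algebra_simps flip: linear_formD(1)[OF lin])
    finally show ?case .
  qed
  \<comment> \<open>Here \<open>l g 1\<close> is \<open>\<gamma> g\<close>, so \<open>l_flip\<close>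
    gives \<open>- 2 * \<gamma> g\<close> for \<open>l 1 g\<close>, and passing to \<open>D\<close>
    subtracts another \<open>\<gamma> g\<close>.\<close>
  have \<gamma>_eq: "\<phi> (pderiv g) = - 3 * \<gamma> g" for g
    using D_eq[of 1 g] l_flip[of g 1]
    by (simp add: D_def l_def \<gamma>_def eq_neg_iff_add_eq_0 algebra_simps)
  have rel: "\<phi> (smult 4 (u * pderiv f) + pderiv u * f) = 0" for u
  proof -
    have "l u f + l 1 (f * u) = 0"
      using l_f[of u 1] by simp
    then have "(D u f + \<gamma> (u * f)) + (D 1 (u * f) + \<gamma> (u * f)) = 0"
      by (simp add: D_def mult.commute)
    then have "3 * \<phi> (u * pderiv f) + \<phi> (pderiv (u * f)) = 0"
      using \<gamma>_eq[of "u * f"] by (simp add: D_eq algebra_simps)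
    then show ?thesis
      by (simp add: pderiv_mult linear_formD[OF lin] mult.commute)
  qed
  have \<phi>_power: "\<phi> (?t ^ n) = 0" for n
  proof (induction n rule: less_induct)
    case (less n)
    consider "n = 0" | "n = 1" | m where "n = Suc (Suc m)"
      by (metis One_nat_def nat.exhaust)
    then show ?case
    proof cases
      case 1
      then show ?thesis
        using \<gamma>_eq[of ?t] normalized by (simp add: \<gamma>_def pderiv_pCons one_pCons)
    next
      case 2
      have "smult 4 (1 * pderiv f) + pderiv 1 * f = smult 8 ?t + smult (- 4 * (a + b)) 1"
        by (simp add: f_def pderiv_mult pderiv_pCons one_pCons algebra_simps)
      then have "8 * \<phi> ?t + - 4 * (a + b) * \<phi> 1 = 0"
        using rel[of 1] by (simp only: linear_formD[OF lin])
      then show ?thesis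
        using less.IH[of 0] 2 by simp
    next
      case 3
      \<comment> \<open>The relation for \<open>?t ^ Suc m\<close> is a three-term recursion; its
        leading coefficient \<open>9 + of_nat m\<close>, being 8 from the first product plus
        \<open>Suc m\<close> from the second, never vanishes.\<close>
      have "smult 4 (?t ^ Suc m * pderiv f) + pderiv (?t ^ Suc m) * f =
          smult (9 + of_nat m) (?t ^ Suc (Suc m)) + smult (- (5 + of_nat m) * (a + b)) (?t ^ Suc m)
          + smult ((1 + of_nat m) * (a * b)) (?t ^ m)"
      proof -
        define t s p where "t = ?t" and "s = [:a + b:]" and "p = [:a * b:]"
        have f: "f = t * t - s * t + p" and f': "pderiv f = 2 * t - s"
          by (simp_all add: f_def t_def s_def p_def pderiv_mult pderiv_pCons one_pCons numeral_poly
              algebra_simps)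
        have u': "pderiv (t ^ Suc m) = (1 + of_nat m) * t ^ m"
          by (simp add: t_def pderiv_power_Suc pderiv_pCons of_nat_poly one_pCons del: power_Suc)
        have smult: "smult 4 X = 4 * X" "smult (9 + of_nat m) X = (9 + of_nat m) * X"
          "smult (- (5 + of_nat m) * (a + b)) X = - (5 + of_nat m) * (s * X)"
          "smult ((1 + of_nat m) * (a * b)) X = (1 + of_nat m) * (p * X)" for X
          by (simp_all add: s_def p_def of_nat_poly numeral_poly one_pCons mult.commute)
        show ?thesis
          unfolding smult t_def[symmetric] f' u' unfolding f by (simp add: algebra_simps)
      qed
      then have "(9 + of_nat m) * \<phi> (?t ^ Suc (Suc m)) + - (5 + of_nat m) * (a + b) * \<phi> (?t ^ Suc m)
          + (1 + of_nat m) * (a * b) * \<phi> (?t ^ m) = 0"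
        using rel[of "?t ^ Suc m"] by (simp only: linear_formD[OF lin])
      then have "(9 + of_nat m) * \<phi> (?t ^ n) = 0"
        using less.IH[of "Suc m"] less.IH[of m] 3 by (simp del: power_Suc)
      moreover have "9 + of_nat m \<noteq> (0 :: complex)"
        by (metis add.commute of_nat_add of_nat_eq_0_iff of_nat_numeral add_eq_0_iff_both_eq_0
            zero_neq_numeral)
      ultimately show ?thesis
        by simp
    qed
  qed
  have "\<phi> g = 0" for g
    by (induction g rule: poly_induct_power) (simp_all add: linear_formD[OF lin] \<phi>_power)
  then have "A (f * u) v = 0" for u v
    using \<gamma>_eq[of "u * v"] D_eq[of u v] by (simp add: D_def l_def)
  then show ?thesis
    using skew_form_mod_f[OF A _ skew] that by blast
qed

text \<open>Subtracting the right multiple of the period form reaches the normalized case.\<close>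

lemma cyclic_skew_form:
  assumes A: "bilinear_form A" and skew: "\<And>u v. A u v = - A v u"
    and cyc: "\<And>u v w. A (f * (u * v)) w + A (f * (v * w)) u + A (f * (w * u)) v = 0"
  obtains x z where "\<And>u v. A u v = x * period_form u v + z * cross_form u v"
proof -
  define x where "x = A (f * [:0, 1:]) 1 / period_form (f * [:0, 1:]) 1"
  define A' where "A' u v = 1 * A u v + (- x) * period_form u v" for u v
  have "bilinear_form A'"
    unfolding A'_def by (intro bilinear_form_lincomb A bilinear_period_form)
  moreover have "A' u v = - A' v u" for u v
    using skew[of u v] period_form_skew[of u v] by (simp add: A'_def)
  moreover have "A' (f * (u * v)) w + A' (f * (v * w)) u + A' (f * (w * u)) v = 0" for u v w
  proof -
    have "A' (f * (u * v)) w + A' (f * (v * w)) u + A' (f * (w * u)) v =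
      (A (f * (u * v)) w + A (f * (v * w)) u + A (f * (w * u)) v) -
      x * (period_form (f * (u * v)) w + period_form (f * (v * w)) u + period_form (f * (w * u)) v)"
      by (simp add: A'_def algebra_simps)
    then show ?thesis by (simp add: cyc period_form_cyclic)
  qed
  moreover have "A' (f * [:0, 1:]) 1 = 0"
    using period_form_f_t_1 by (simp add: A'_def x_def)
  ultimately obtain z where "\<And>u v. A' u v = z * cross_form u v"
    using normalized_cyclic_skew_form by blast
  then show ?thesis
    by (intro that[of x z]) (simp add: A'_def algebra_simps)
qed

text \<open>For components at two different basis vectors the form is neither symmetric nor skew.
  Having the identity in both arguments lets it pass to the symmetric and the skew part
  separately.\<close>

lemma mixed_form:
  assumes V: "bilinear_form V"
    and cyc: "\<And>u v w. V (f * (u * v)) w = V (f * (v * w)) u"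
      "\<And>u v w. V w (f * (u * v)) = V u (f * (v * w))"
  obtains \<phi> x y z w where "linear_form \<phi>"
    "\<And>u v. V u v = \<phi> (u * v) + x * jet_form a u v + y * jet_form b u v
      + z * (poly u a * poly v b) + w * (poly u b * poly v a)"
proof -
  define B C where "B u v = 1/2 * V u v + 1/2 * V v u" and "C u v = 1/2 * V u v + (- 1/2) * V v u"
      for u v
  have "bilinear_form B" "bilinear_form C"
    unfolding B_def C_def by (intro bilinear_form_lincomb V bilinear_form_flip)+
  moreover have "B u v = B v u" "C u v = - C v u" for u v
    by (simp_all add: B_def C_def)
  moreover have "B (f * (u * v)) w = B (f * (v * w)) u"
      "C (f * (u * v)) w = C (f * (v * w)) u" for u v w
    using cyc(1)[of u v w] cyc(2)[of w u v] by (simp_all add: B_def C_def)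
  ultimately obtain \<phi> z x y z' where \<phi>: "linear_form \<phi>"
    and "\<And>u v. B u v = \<phi> (u * v) + z * (poly u a * poly v b + poly u b * poly v a)"
      "\<And>u v. C u v = x * jet_form a u v + y * jet_form b u v + z' * cross_form u v"
    by (metis symmetric_form_totally_symmetric_on_f[of B] skew_form_totally_symmetric_on_f[of C])
  moreover have "V u v = B u v + C u v" for u v
    by (simp add: B_def C_def)
  ultimately show ?thesis
    by (intro that[OF \<phi>, of x y "z + z'" "z - z'"]) (simp add: cross_form_def algebra_simps)
qed

text \<open>
  \<open>V\<close> and \<open>K\<close> stand for the components of a cocycle at the basis pairs \<open>(e, f)\<close> and \<open>(h, h)\<close>. In
  terms of the \<open>V(0)\<close>-part \<open>A\<close> and the \<open>V(4)\<close>-part \<open>C\<close> of the cocycle, the skew part of \<open>V\<close> is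
  \<open>A - C\<close>, and \<open>K = 2 A + 4 C\<close>.
\<close>

lemma weight_zero_forms:
  assumes V: "bilinear_form V" and K: "bilinear_form K" and skew: "\<And>u v. K u v = - K v u"
    and rel: "\<And>u v w. K (f * (u * v)) w - 2 * V u (f * (v * w)) + 2 * V (f * (w * u)) v = 0"
  obtains \<phi> \<mu> x y z w s where "linear_form \<phi>"
    "\<And>u v. V u v = \<phi> (u * v) + \<mu> * period_form u v - x * jet_form a u v - y * jet_form b u v
      + z * (poly u a * poly v b) + w * (poly u b * poly v a)"
    "\<And>u v. K u v = 2 * \<mu> * period_form u v + 4 * x * jet_form a u v + 4 * y * jet_form b u v
      + s * cross_form u v"
proof -
  define B N where "B u v = 1/2 * V u v + 1/2 * V v u" and "N u v = 1/2 * V u v + (- 1/2) * V v u"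
      for u v
  \<comment> \<open>The solution of the linear system in which \<open>N\<close> is
    \<open>A - C\<close> and \<open>K\<close> is \<open>2 A + 4 C\<close>.\<close>
  define A C where "A u v = 2/3 * N u v + 1/6 * K u v" and "C u v = 1/6 * K u v + (- 1/3) * N u v"
      for u v
  have bil: "bilinear_form B" "bilinear_form N"
    unfolding B_def N_def by (intro bilinear_form_lincomb V bilinear_form_flip)+
  have bil': "bilinear_form A" "bilinear_form C"
    unfolding A_def C_def by (intro bilinear_form_lincomb bil K)+
  have sym: "B u v = B v u" "N u v = - N v u" for u v
    by (simp_all add: B_def N_def)
  have skew': "A u v = - A v u" "C u v = - C v u" for u v
    using sym(2)[of u v] skew[of u v] by (simp_all add: A_def C_def)
  have lin: "k + (p + r) = q + t" "t / 2 + p / 2 = q / 2 + r / 2"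
    if "k + 2 * p = 2 * q" "k + 2 * r = 2 * t" for k p q r t :: complex
  proof -
    have k: "k = 2 * q - 2 * p"
      using that(1) by (simp add: algebra_simps)
    have "2 * t = 2 * (q - p + r)"
      using that(2) by (simp add: k algebra_simps)
    then have t: "t = q - p + r"
      by (simp only: mult_cancel_left) simp
    show "k + (p + r) = q + t" "t / 2 + p / 2 = q / 2 + r / 2"
      by (simp_all add: k t add_divide_distrib diff_divide_distrib)
  qed
  \<comment> \<open>The sum of \<open>rel\<close> for \<open>u, v, w\<close> and for
    \<open>v, u, w\<close> involves only the skew part of \<open>V\<close>, the difference only the
    symmetric part.\<close>
  have K_N: "K (f * (u * v)) w = - 2 * N (f * (w * u)) v - 2 * N (f * (v * w)) u"
    and B_cyc: "B (f * (w * u)) v = B (f * (v * w)) u" for u v w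
    using rel[of u v w] rel[of v u w]
    by (simp_all add: N_def B_def algebra_simps lin)
  obtain \<phi> z where \<phi>: "linear_form \<phi>"
    "\<And>u v. B u v = \<phi> (u * v) + z * (poly u a * poly v b + poly u b * poly v a)"
    using symmetric_form_totally_symmetric_on_f[OF bil(1) sym(1)] B_cyc by metis
  have "A (f * (u * v)) w + A (f * (v * w)) u + A (f * (w * u)) v = 0" for u v w
    unfolding A_def K_N by (simp add: field_simps)
  then obtain \<mu> \<nu> where \<mu>: "\<And>u v. A u v = \<mu> * period_form u v + \<nu> * cross_form u v"
    using cyclic_skew_form[OF bil'(1) skew'(1)] by metis
  have "C (f * (u * v)) w = C (f * (v * w)) u" for u v w
    unfolding C_def K_N by (simp add: field_simps)
  then obtain x y z' where C: "\<And>u v. C u v = x * jet_form a u v + y * jet_form b u v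
      + z' * cross_form u v"
    using skew_form_totally_symmetric_on_f[OF bil'(2) skew'(2)] by metis
  have "V u v = B u v + A u v - C u v" "K u v = 2 * A u v + 4 * C u v" for u v
    unfolding A_def C_def B_def N_def by (simp_all add: field_simps)
  then show ?thesis
    by (intro that[OF \<phi>(1), of \<mu> x y "z + \<nu> - z'" "z - \<nu> + z'" "2 * \<nu> + 4 * z'"])
      (simp_all add: \<phi> \<mu> C cross_form_def algebra_simps)
qed

end

section \<open>Invariant pairings and jets\<close>

text \<open>
  \<open>sl2_coords X\<close> lists the coefficients of the binary quadratic form attached to \<open>X\<close>, scaled so
  that \<open>\<lambda>X. \<Sum>i\<le>2. u i * sl2_coords X i\<close> turns \<open>V(2)\<close> into the dual of the adjoint module.
\<close>

definition sl2_coords :: "cmat \<Rightarrow> nat \<Rightarrow> complex" where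
  "sl2_coords X i = (if i = 0 then X $ 2 $ 1 else if i = 1 then - 2 * X $ 1 $ 1 else - X $ 1 $ 2)"

definition pairing :: "(nat \<times> nat \<Rightarrow> complex) \<Rightarrow> cmat \<Rightarrow> cmat \<Rightarrow> complex" where
  "pairing T X Y = (\<Sum>i<3. \<Sum>j<3. T (i, j) * (sl2_coords X i * sl2_coords Y j))"

text \<open>Contracting \<open>V(4)\<close> with the product of two quadratic forms.\<close>

abbreviation quartic_pairing :: "(nat \<Rightarrow> complex) \<Rightarrow> cmat \<Rightarrow> cmat \<Rightarrow> complex" where
  "quartic_pairing u \<equiv> pairing (\<lambda>(i, j). u (i + j))"

lemma pairing_expand:
  "pairing T X Y = T (0, 0) * (X $ 2 $ 1 * Y $ 2 $ 1) - T (0, 1) * (X $ 2 $ 1 * (2 * Y $ 1 $ 1))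
      - T (0, 2) * (X $ 2 $ 1 * Y $ 1 $ 2)
    - T (1, 0) * (2 * X $ 1 $ 1 * Y $ 2 $ 1) + T (1, 1) * (2 * X $ 1 $ 1 * (2 * Y $ 1 $ 1))
        + T (1, 2) * (2 * X $ 1 $ 1 * Y $ 1 $ 2)
    - T (2, 0) * (X $ 1 $ 2 * Y $ 2 $ 1) + T (2, 1) * (X $ 1 $ 2 * (2 * Y $ 1 $ 1))
        + T (2, 2) * (X $ 1 $ 2 * Y $ 1 $ 2)"
  by (simp add: pairing_def sl2_coords_def eval_nat_numeral)

lemma pairing_linear:
  "pairing T (X + X') Y = pairing T X Y + pairing T X' Y"
      "pairing T X (Y + Y') = pairing T X Y + pairing T X Y'"
  "pairing T (map_matrix ((*) c) X) Y = c * pairing T X Y"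
      "pairing T X (map_matrix ((*) c) Y) = c * pairing T X Y"
  "pairing T 0 Y = 0" "pairing T X 0 = 0"
  by (simp_all add: pairing_expand algebra_simps)

lemma pairing_lincomb:
  "pairing (\<lambda>ij. c * T ij + d * T' ij) X Y = c * pairing T X Y + d * pairing T' X Y"
  by (simp add: pairing_def sum.distrib sum_distrib_left algebra_simps)

lemma quartic_pairing_expand:
  "quartic_pairing u X Y = u 0 * (X $ 2 $ 1 * Y $ 2 $ 1) - 2 * u 1 * (X $ 2 $ 1 * Y $ 1 $ 1
      + X $ 1 $ 1 * Y $ 2 $ 1)
    + u 2 * (4 * X $ 1 $ 1 * Y $ 1 $ 1 - X $ 2 $ 1 * Y $ 1 $ 2 - X $ 1 $ 2 * Y $ 2 $ 1)
    + 2 * u 3 * (X $ 1 $ 1 * Y $ 1 $ 2 + X $ 1 $ 2 * Y $ 1 $ 1) + u 4 * (X $ 1 $ 2 * Y $ 1 $ 2)"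
  by (simp add: pairing_expand numeral_2_eq_2[symmetric]) (simp add: algebra_simps)

lemma quartic_pairing_sym: "quartic_pairing u X Y = quartic_pairing u Y X"
  by (simp add: quartic_pairing_expand algebra_simps)

lemma quartic_pairing_cyclic:
  assumes "X \<in> sl2" "Y \<in> sl2" "Z \<in> sl2"
  shows "quartic_pairing u (commutator X Y) Z + quartic_pairing u (commutator Y Z) X
    + quartic_pairing u (commutator Z X) Y = 0"
  using assms unfolding quartic_pairing_expand
  by (simp add: mat2_simps mem_sl2_iff) (simp add: algebra_simps)

text \<open>The scaling in \<open>sl2_coords\<close> is chosen for this identity: it matches the
  basis of \<open>sl2_irrep 2\<close> with the dual of the adjoint action in each argument.\<close>

lemma pairing_equivariant:
  assumes "x \<in> sl2" "y \<in> sl2" "X \<in> sl2" "Y \<in> sl2" and T: "\<And>i j. i > 2 \<or> j > 2 \<Longrightarrow> T (i, j) = 0"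
  shows "pairing (mact (sl2_irrep 2 \<boxtimes> sl2_irrep 2) (x, y) T) X Y =
    - pairing T (commutator x X) Y - pairing T X (commutator y Y)"
  using assms(1-4) T[of 3] T[of _ 3]
  by (simp add: pairing_expand mat2_simps mem_sl2_iff sl2_irrep_def numeral_2_eq_2[symmetric]) (simp
      add: algebra_simps)

lemma quartic_pairing_equivariant:
  assumes "x \<in> sl2" "X \<in> sl2" "Y \<in> sl2" "\<And>i. i > 4 \<Longrightarrow> u i = 0"
  shows "quartic_pairing (mact (sl2_irrep 4) x u) X Y =
    - quartic_pairing u (commutator x X) Y - quartic_pairing u X (commutator x Y)"
  using assms unfolding quartic_pairing_expand
  by (simp add: mat2_simps mem_sl2_iff sl2_irrep_def numeral_2_eq_2[symmetric]) (simp add: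
      algebra_simps)

section \<open>Jets of currents, trace identities and lifting by interpolation\<close>

definition jet1 :: "complex \<Rightarrow> pmat \<Rightarrow> cmat" where
  "jet1 c g = eval_at c (map_matrix pderiv g)"

definition jet2 :: "complex \<Rightarrow> pmat \<Rightarrow> cmat" where
  "jet2 c g = eval_at c (map_matrix pderiv (map_matrix pderiv g))"

lemma jet_nth [simp]:
  "eval_at c g $ i $ j = poly (g $ i $ j) c" "jet1 c g $ i $ j = poly (pderiv (g $ i $ j)) c"
  "jet2 c g $ i $ j = poly (pderiv (pderiv (g $ i $ j))) c"
  by (simp_all add: jet1_def jet2_def eval_at_def)

lemma jet_linear:
  "jet1 c (g + h) = jet1 c g + jet1 c h" "jet1 c (map_matrix (smult d) g)
      = map_matrix ((*) d) (jet1 c g)"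
  "jet2 c (g + h) = jet2 c g + jet2 c h" "jet2 c (map_matrix (smult d) g)
      = map_matrix ((*) d) (jet2 c g)"
  by (simp_all add: vec_eq_iff pderiv_add pderiv_smult)

text \<open>In the Leibniz expansion every term containing the value of \<open>h\<close> or the
  first derivative of \<open>g\<close> at \<open>c\<close> drops out.\<close>

lemma jet_commutator:
  assumes "\<And>i j. poly (h $ i $ j) c = 0" "jet1 c g = 0"
  shows "jet1 c (commutator g h) = commutator (eval_at c g) (jet1 c h)"
    "jet2 c (commutator g h) = commutator (eval_at c g) (jet2 c h)"
  using assms by (simp_all add: mat2_simps pderiv_mult pderiv_add pderiv_diff)

lemma jet_commutator_vanishing:
  assumes "\<And>i j. poly (g $ i $ j) c = 0" "\<And>i j. poly (h $ i $ j) c = 0"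
  shows "jet1 c (commutator g h) = 0"
    "jet2 c (commutator g h) = map_matrix ((*) 2) (commutator (jet1 c g) (jet1 c h))"
  using assms by (simp_all add: mat2_simps pderiv_mult pderiv_add pderiv_diff)

abbreviation pmat_deriv :: "pmat \<Rightarrow> pmat" where
  "pmat_deriv \<equiv> map_matrix pderiv"

lemma trace_deriv_product: "trace (g ** pmat_deriv h) + trace (h ** pmat_deriv g)
    = pderiv (trace (g ** h))"
  by (simp add: trace_def mat2_simps pderiv_add pderiv_mult algebra_simps)

text \<open>By invariance of the trace form, each term on the left differentiates one factor of the
  same trilinear expression.\<close>

lemma trace_deriv_commutator:
  "trace (commutator g h ** pmat_deriv k) + trace (commutator h k ** pmat_deriv g)
    + trace (commutator k g ** pmat_deriv h) = pderiv (trace (commutator g h ** k))"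
  by (simp add: trace_def mat2_simps pderiv_add pderiv_diff pderiv_mult algebra_simps)

text \<open>Invariance cancels the terms that differentiate \<open>k\<close>. What remains depends
  on \<open>h\<close> and \<open>k\<close> only through their commutator, and so will integrate to a
  coboundary.\<close>

lemma trace_deriv_coadjoint:
  "trace (commutator g h ** pmat_deriv k) + trace (h ** pmat_deriv (commutator g k))
    = - trace (pmat_deriv g ** commutator h k)"
  by (simp add: trace_def mat2_simps pderiv_add pderiv_diff pderiv_mult algebra_simps)

lemma hermite_interpolation:
  assumes "a \<noteq> b"
  obtains e :: "complex poly" where "poly e a = 1" "poly e b = 0" "poly (pderiv e) a = 0"
      "poly (pderiv e) b = 0"
proof
  \<comment> \<open>The cubic \<open>3 s^2 - 2 s^3\<close> in the variable
    \<open>s = (t - b) / (a - b)\<close>.\<close>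
  let ?e = "smult (1 / (a - b) ^ 3) ([:- b, 1:] ^ 2 * ([:3 * (a - b):] - 2 * [:- b, 1:]))"
  show "poly ?e a = 1" "poly ?e b = 0" "poly (pderiv ?e) a = 0" "poly (pderiv ?e) b = 0"
    using assms by (simp_all add: pderiv_smult pderiv_mult pderiv_diff pderiv_pCons power2_eq_square
        power3_eq_cube numeral_poly divide_simps) (simp_all add: algebra_simps)
qed

lemma mem_sl2_tensor_UNIV_iff: "g \<in> sl2_tensor UNIV \<longleftrightarrow> g $ 2 $ 2 = - g $ 1 $ 1"
  by (subst mem_sl2_tensor_iff) (auto simp: trace_def sum_2 eq_neg_iff_add_eq_0 add.commute)

lemma sl2_sl2_lift:
  assumes "a \<noteq> b" "x \<in> sl2" "y \<in> sl2"
  obtains g where "g \<in> sl2_tensor UNIV" "eval_at a g = x" "eval_at b g = y" "jet1 a g = 0"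
      "jet1 b g = 0"
proof -
  obtain e where e: "poly e a = 1" "poly e b = 0" "poly (pderiv e) a = 0" "poly (pderiv e) b = 0"
    using hermite_interpolation[OF assms(1)] .
  show ?thesis
    by (rule that[of "pure_tensor x e + pure_tensor y (1 - e)"])
      (use assms e in \<open>simp_all add: mem_sl2_tensor_UNIV_iff mem_sl2_iff vec_eq_iff pure_tensor_def
        pderiv_add pderiv_smult pderiv_diff\<close>)
qed

section \<open>The explicit cocycles\<close>

definition wedge :: "(nat \<times> nat \<Rightarrow> complex) \<Rightarrow> (pmat \<Rightarrow> cmat) \<Rightarrow> (pmat \<Rightarrow> cmat) \<Rightarrow> pmat \<Rightarrow> pmat \<Rightarrow> complex"
    where
  "wedge T D D' g h = pairing T (D g) (D' h) - pairing T (D h) (D' g)"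

lemma wedge_lincomb:
  "wedge (\<lambda>ij. c * T ij + d * T' ij) D D' g h = c * wedge T D D' g h + d * wedge T' D D' g h"
  by (simp add: wedge_def pairing_lincomb algebra_simps)

lemma wedge_linear:
  assumes "\<And>g h. D (g + h) = D g + D h" "\<And>c g. D (map_matrix (smult c) g)
      = map_matrix ((*) c) (D g)"
    and "\<And>g h. D' (g + h) = D' g + D' h" "\<And>c g. D' (map_matrix (smult c) g)
        = map_matrix ((*) c) (D' g)"
  shows "wedge T D D' (g + h) k = wedge T D D' g k + wedge T D D' h k"
    "wedge T D D' k (g + h) = wedge T D D' k g + wedge T D D' k h"
    "wedge T D D' (map_matrix (smult c) g) k = c * wedge T D D' g k"
    "wedge T D D' k (map_matrix (smult c) g) = c * wedge T D D' k g"
  by (simp_all add: wedge_def assms pairing_linear algebra_simps)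

lemma wedge_self: "wedge T D D' g g = 0"
  by (simp add: wedge_def)

type_synonym params = "(unit \<times> unit \<Rightarrow> complex) \<times> (nat \<times> nat \<Rightarrow> complex)
  \<times> (nat \<times> unit \<Rightarrow> complex) \<times> (unit \<times> nat \<Rightarrow> complex)"

abbreviation target_module :: "(cmat \<times> cmat, params) lie_mod" where
  "target_module \<equiv> trivial_module \<boxtimes> trivial_module \<oplus>\<^sub>m sl2_irrep 2 \<boxtimes> sl2_irrep 2 \<oplus>\<^sub>m
     sl2_irrep 4 \<boxtimes> trivial_module \<oplus>\<^sub>m trivial_module \<boxtimes> sl2_irrep 4"

text \<open>Brings the carrier into the shape required by \<open>lie_module_ext_tensor\<close> and
  keeps the action abstract.\<close>

lemma sl2_irrep_coord_module:
  obtains \<rho> where "sl2_irrep m = coord_module {v. \<forall>i. i \<notin> {..m} \<longrightarrow> v i = 0} \<rho>"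
  unfolding sl2_irrep_def by (simp add: not_le)

lemma trivial_module_coord_module:
  obtains \<rho> where "trivial_module = coord_module {v. \<forall>i. i \<notin> {()} \<longrightarrow> v i = 0} \<rho>"
  unfolding trivial_module_def by simp

lemma lie_module_target: "gl2_gl2.lie_module (sl2 \<times> sl2) target_module"
proof -
  obtain \<rho>2 where 2: "sl2_irrep 2 = coord_module {v. \<forall>i. i \<notin> {..2} \<longrightarrow> v i = 0} \<rho>2"
    by (rule sl2_irrep_coord_module)
  obtain \<rho>4 where 4: "sl2_irrep 4 = coord_module {v. \<forall>i. i \<notin> {..4} \<longrightarrow> v i = 0} \<rho>4"
    by (rule sl2_irrep_coord_module)
  obtain \<rho>0 where 0: "trivial_module = coord_module {v. \<forall>i. i \<notin> {()} \<longrightarrow> v i = 0} (\<rho>0 :: cmat \<Rightarrow> _)"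
    by (rule trivial_module_coord_module)
  show ?thesis
    by (intro lie_module_direct_sum lie_module_ext_tensor[OF lie_module_trivial_module 0 _
        lie_module_trivial_module 0]
        lie_module_ext_tensor[OF lie_module_sl2_irrep 2 _ lie_module_sl2_irrep 2]
        lie_module_ext_tensor[OF lie_module_sl2_irrep 4 _ lie_module_trivial_module 0]
        lie_module_ext_tensor[OF lie_module_trivial_module 0 _ lie_module_sl2_irrep 4]) simp_all
qed

lemma target_carrier:
  "(z, T, u, v) \<in> mcarrier target_module \<longleftrightarrow> (\<forall>i j. i > 2 \<or> j > 2 \<longrightarrow> T (i, j) = 0) \<and>
    (\<forall>i>4. u (i, ()) = 0) \<and> (\<forall>i>4. v ((), i) = 0)"
proof -
  have s: "mcarrier (sl2_irrep m) = {v. \<forall>i. i \<notin> {..m} \<longrightarrow> v i = 0}" for m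
    by (auto simp: sl2_irrep_def)
  have t: "mcarrier trivial_module = {v. \<forall>i. i \<notin> {()} \<longrightarrow> v i = (0 :: complex)}"
    by (simp add: trivial_module_def)
  show ?thesis
    by (simp add: direct_sum_def ext_tensor_carrier[OF _ s s] ext_tensor_carrier[OF _ s t]
        ext_tensor_carrier[OF _ t s] ext_tensor_carrier[OF _ t t] not_le)
qed

lemma target_ops:
  "madd target_module (z, T, u, v) (z', T', u', v') =
    (\<lambda>i. z i + z' i, \<lambda>i. T i + T' i, \<lambda>i. u i + u' i, \<lambda>i. v i + v' i)"
  "mscale target_module c (z, T, u, v) = (\<lambda>i. c * z i, \<lambda>i. c * T i, \<lambda>i. c * u i, \<lambda>i. c * v i)"
  "mact target_module xy (z, T, u, v) = (mact (trivial_module \<boxtimes> trivial_module) xy z,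
    mact (sl2_irrep 2 \<boxtimes> sl2_irrep 2) xy T, mact (sl2_irrep 4 \<boxtimes> trivial_module) xy u,
    mact (trivial_module \<boxtimes> sl2_irrep 4) xy v)"
  by (simp_all add: direct_sum_def ext_tensor_ops)

section \<open>Cocycles on the ideal \<open>L\<close> attached to the parameters of the target
  module\<close>

context two_points
begin

definition L :: "pmat set" where
  "L = sl2_tensor {p. f dvd p}"

lemma mem_L_iff: "g \<in> L \<longleftrightarrow> g $ 2 $ 2 = - g $ 1 $ 1 \<and> (\<forall>i j. f dvd g $ i $ j)"
  unfolding L_def
  by (subst mem_sl2_tensor_iff) (auto simp: trace_def sum_2 eq_neg_iff_add_eq_0 add.commute
      dvd_smult)

lemma L_vanishes: "g \<in> L \<Longrightarrow> poly (g $ i $ j) a = 0" "g \<in> L \<Longrightarrow> poly (g $ i $ j) b = 0"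
  by (simp_all add: mem_L_iff f_dvd_iff)

lemma subspace_L: "gl2t.subspace L"
  unfolding gl2t.subspace_def by (auto simp: mem_L_iff dvd_add dvd_smult)

lemma bracket_L: 
  assumes "g \<in> sl2_tensor UNIV" "h \<in> L"
  shows "commutator g h \<in> L"
  using assms by (auto simp: mem_L_iff mem_sl2_tensor_UNIV_iff f_dvd_iff mat2_simps)

lemma L_subset: "L \<subseteq> sl2_tensor UNIV"
  by (auto simp: mem_L_iff mem_sl2_tensor_UNIV_iff)

lemma L_closed: "g \<in> L \<Longrightarrow> h \<in> L \<Longrightarrow> commutator g h \<in> L"
  using bracket_L L_subset by blast

text \<open>\<open>L\<close> is the kernel of evaluation at both points, so two preimages of the
  same pair of matrices act alike on cohomology.\<close>

lemma kernel_eval: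
  assumes "g \<in> sl2_tensor UNIV" "h \<in> sl2_tensor UNIV" "eval_at a g = eval_at a h"
      "eval_at b g = eval_at b h"
  shows "g - h \<in> L"
proof -
  have "poly (g $ i $ j) c = poly (h $ i $ j) c" if "c = a \<or> c = b" for i j c
    using that assms(3,4) by (metis jet_nth(1))
  then show ?thesis
    using assms(1,2) by (auto simp: mem_L_iff mem_sl2_tensor_UNIV_iff f_dvd_iff)
qed

lemma jet_L_sl2:
  assumes "g \<in> L"
  shows "jet1 c g \<in> sl2" "jet2 c g \<in> sl2"
  using assms by (simp_all add: mem_L_iff mem_sl2_iff pderiv_minus)

text \<open>An analogue of the affine Kac-Moody cocycle, with integration from \<open>a\<close> to
  \<open>b\<close> in place of a residue.\<close>

definition period :: "pmat \<Rightarrow> pmat \<Rightarrow> complex" where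
  "period g h = poly_period a b (trace (g ** pmat_deriv h))"

lemma period_linear:
  "period (g + h) k = period g k + period h k" "period k (g + h) = period k g + period k h"
  "period (map_matrix (smult c) g) k = c * period g k"
      "period k (map_matrix (smult c) g) = c * period k g"
proof -
  note J = linear_formD[OF linear_form_poly_period[of a b]]
  have "trace ((g + h) ** pmat_deriv k) = trace (g ** pmat_deriv k) + trace (h ** pmat_deriv k)"
    "trace (k ** pmat_deriv (g + h)) = trace (k ** pmat_deriv g) + trace (k ** pmat_deriv h)"
    "trace (map_matrix (smult c) g ** pmat_deriv k) = smult c (trace (g ** pmat_deriv k))"
    "trace (k ** pmat_deriv (map_matrix (smult c) g)) = smult c (trace (k ** pmat_deriv g))"
    by (simp_all add: trace_def mat2_simps pderiv_add pderiv_smult smult_add_right algebra_simps)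
  then show "period (g + h) k = period g k + period h k"
      "period k (g + h) = period k g + period k h"
    "period (map_matrix (smult c) g) k = c * period g k"
        "period k (map_matrix (smult c) g) = c * period k g"
    by (simp_all only: period_def J)
qed

lemma period_skew:
  assumes "g \<in> L" "h \<in> L"
  shows "period g h = - period h g"
proof -
  have "period g h + period h g = poly_period a b (pderiv (trace (g ** h)))"
    by (simp only: period_def trace_deriv_product[symmetric] linear_formD[OF
        linear_form_poly_period])
  also have "\<dots> = 0"
    unfolding poly_period_pderiv using assms by (simp add: trace_def mat2_simps L_vanishes)
  finally show ?thesis by (simp add: eq_neg_iff_add_eq_0)
qed

lemma period_cyclic:
  assumes "g \<in> L" "h \<in> L" "k \<in> L"
  shows "period (commutator g h) k + period (commutator h k) g + period (commutator k g) h = 0"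
proof -
  have "period (commutator g h) k + period (commutator h k) g + period (commutator k g) h
      = poly_period a b (pderiv (trace (commutator g h ** k)))"
    by (simp only: period_def trace_deriv_commutator[symmetric] linear_formD[OF
        linear_form_poly_period])
  also have "\<dots> = 0"
    unfolding poly_period_pderiv using assms by (simp add: trace_def mat2_simps L_vanishes)
  finally show ?thesis .
qed

fun cocycle_of :: "params \<Rightarrow> pmat \<Rightarrow> pmat \<Rightarrow> complex" where
  "cocycle_of (z, T, u, v) g h = (if g \<in> L \<and> h \<in> L then
     z ((), ()) * period g h + wedge T (jet1 a) (jet1 b) g h
     + wedge (\<lambda>(i, j). u (i + j, ())) (jet1 a) (jet2 a) g h
     + wedge (\<lambda>(i, j). v ((), i + j)) (jet1 b) (jet2 b) g h else 0)"

lemma cocycle_of_lincomb: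
  "cocycle_of (\<lambda>i. c * z i + d * z' i, \<lambda>i. c * T i + d * T' i, \<lambda>i. c * u i + d * u' i, \<lambda>i. c * v i
      + d * v' i) g h
    = c * cocycle_of (z, T, u, v) g h + d * cocycle_of (z', T', u', v') g h"
proof -
  have "wedge (\<lambda>(i, j). c * u (i + j, ()) + d * u' (i + j, ())) D D' g h =
      c * wedge (\<lambda>(i, j). u (i + j, ())) D D' g h + d * wedge (\<lambda>(i, j). u' (i + j, ())) D D' g h"
    "wedge (\<lambda>(i, j). c * v ((), i + j) + d * v' ((), i + j)) D D' g h =
      c * wedge (\<lambda>(i, j). v ((), i + j)) D D' g h + d * wedge (\<lambda>(i, j). v' ((), i + j)) D D' g h"
    for D D'
    by (simp_all add: case_prod_unfold flip: wedge_lincomb)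
  then show ?thesis
    by (simp add: wedge_lincomb algebra_simps)
qed

lemma cocycle_of_cochains2: "cocycle_of P \<in> gl2t.cochains2 L"
proof -
  obtain z T u v where P: "P = (z, T, u, v)" by (cases P)
  note closed = gl2t.subspace_add[OF subspace_L] gl2t.subspace_scale[OF subspace_L]
  have "period x x = 0" if "x \<in> L" for x
    using period_skew[OF that that] by simp
  then show ?thesis
    unfolding gl2t.cochains2_def P
    by (auto simp: closed period_linear wedge_linear jet_linear wedge_self algebra_simps)
qed

lemma jet_commutator_L:
  assumes "g \<in> L" "h \<in> L"
  shows "jet1 a (commutator g h) = 0" "jet1 b (commutator g h) = 0"
    "jet2 a (commutator g h) = map_matrix ((*) 2) (commutator (jet1 a g) (jet1 a h))"
    "jet2 b (commutator g h) = map_matrix ((*) 2) (commutator (jet1 b g) (jet1 b h))"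
  by (intro jet_commutator_vanishing L_vanishes assms)+

text \<open>First jets of commutators in \<open>L\<close> vanish, which closes the mixed summand at
  once. Second jets of commutators are twice the commutator of first jets, which reduces the quartic
  summands to \<open>quartic_pairing_cyclic\<close>; the period has its own cyclic identity.\<close>

lemma cocycle_of_cocycles2: "cocycle_of P \<in> gl2t.cocycles2 L"
proof -
  obtain z T u v where P: "P = (z, T, u, v)" by (cases P)
  have "gl2t.diff2 L (cocycle_of P) g h k = 0" for g h k
  proof (cases "g \<in> L \<and> h \<in> L \<and> k \<in> L")
    case True
    then have L: "g \<in> L" "h \<in> L" "k \<in> L" by auto
    have skew: "commutator g k = map_matrix (smult (- 1)) (commutator k g)"
      by (simp add: mat2_simps)
    have "period (commutator g k) h = - period (commutator k g) h"
      unfolding skew period_linear by simp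
    then have period: "- period (commutator g h) k + period (commutator g k) h
        - period (commutator h k) g = 0"
      using period_cyclic[OF L] by (simp add: algebra_simps add_eq_0_iff)
    define Q where "Q w c = quartic_pairing w (jet1 c h) (commutator (jet1 c g) (jet1 c k))
      - quartic_pairing w (jet1 c k) (commutator (jet1 c g) (jet1 c h))
      - quartic_pairing w (jet1 c g) (commutator (jet1 c h) (jet1 c k))" for w c
    have quartic: "Q w c = 0" for w c
    proof -
      have skew: "commutator (jet1 c g) (jet1 c k)
          = map_matrix ((*) (- 1)) (commutator (jet1 c k) (jet1 c g))"
        by (simp add: mat2_simps)
      have "Q w c = - (quartic_pairing w (commutator (jet1 c g) (jet1 c h)) (jet1 c k)
          + quartic_pairing w (commutator (jet1 c h) (jet1 c k)) (jet1 c g)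
          + quartic_pairing w (commutator (jet1 c k) (jet1 c g)) (jet1 c h))"
        unfolding Q_def skew pairing_linear quartic_pairing_sym[of w "commutator _ _"] by simp
      then show ?thesis
        using quartic_pairing_cyclic[OF jet_L_sl2(1)[OF L(1)] jet_L_sl2(1)[OF L(2)] jet_L_sl2(1)[OF
            L(3)], of w c c c]
        by simp
    qed
    have "gl2t.diff2 L (cocycle_of P) g h k =
        z ((), ()) * (- period (commutator g h) k + period (commutator g k) h
            - period (commutator h k) g)
        + 2 * - Q (\<lambda>i. u (i, ())) a + 2 * - Q (\<lambda>i. v ((), i)) b"
      by (simp add: P gl2t.diff2_def L L_closed wedge_def jet_commutator_L pairing_linear Q_def)
        (simp add: algebra_simps)
    then show ?thesis
      by (simp only: quartic period) simp
  qed (auto simp: gl2t.diff2_def)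
  then show ?thesis
    by (auto simp: gl2t.cocycles2_def cocycle_of_cochains2 fun_eq_iff)
qed

lemma jet_commutator_lift:
  assumes "h \<in> L" "jet1 a g = 0" "jet1 b g = 0"
  shows "jet1 a (commutator g h) = commutator (eval_at a g) (jet1 a h)"
    "jet2 a (commutator g h) = commutator (eval_at a g) (jet2 a h)"
    "jet1 b (commutator g h) = commutator (eval_at b g) (jet1 b h)"
    "jet2 b (commutator g h) = commutator (eval_at b g) (jet2 b h)"
  by (intro jet_commutator L_vanishes assms)+

text \<open>
  Only the period contributes a coboundary: as \<open>g\<close> has zero derivative at \<open>a\<close> and \<open>b\<close>, the other
  summands are equivariant on the nose.
\<close>

lemma coadjoint2_cocycle_of:
  assumes P: "P \<in> mcarrier target_module" and g: "g \<in> sl2_tensor UNIV" and jet: "jet1 a g = 0"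
      "jet1 b g = 0"
  shows "(\<lambda>h k. gl2t.coadjoint2 L g (cocycle_of P) h k -
    cocycle_of (mact target_module (eval_at a g, eval_at b g) P) h k) \<in> gl2t.coboundaries2 L"
proof -
  obtain z T u v where P_eq: "P = (z, T, u, v)" by (cases P)
  note supp = P[unfolded P_eq target_carrier]
  let ?x = "eval_at a g" and ?y = "eval_at b g"
  note J = linear_formD[OF linear_form_poly_period[of a b]]
  have xy: "?x \<in> sl2" "?y \<in> sl2"
    using g by (simp_all add: mem_sl2_tensor_UNIV_iff mem_sl2_iff)
  \<comment> \<open>The primitive of the failure of the period to be invariant, read off from
    \<open>trace_deriv_coadjoint\<close>.\<close>
  define \<eta> where "\<eta> h = (if h \<in> L then - z ((),
      ()) * poly_period a b (trace (pmat_deriv g ** h)) else 0)" for h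
  have "trace (pmat_deriv g ** (h + k)) = trace (pmat_deriv g ** h) + trace (pmat_deriv g ** k)"
    "trace (pmat_deriv g ** map_matrix (smult c) h) = smult c (trace (pmat_deriv g ** h))" for h k c
    by (simp_all add: trace_def mat2_simps smult_add_right algebra_simps)
  then have "\<eta> \<in> gl2t.cochains1 L"
    by (auto simp: \<eta>_def gl2t.cochains1_def gl2t.subspace_add[OF subspace_L]
        gl2t.subspace_scale[OF subspace_L] J algebra_simps)
  moreover have "gl2t.coadjoint2 L g (cocycle_of P) h k - cocycle_of (mact target_module (?x,
      ?y) P) h k
      = gl2t.diff1 L \<eta> h k" for h k
  proof (cases "h \<in> L \<and> k \<in> L")
    case True
    then have L: "h \<in> L" "k \<in> L" "commutator g h \<in> L" "commutator g k \<in> L" "commutator h k \<in> L"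
      using bracket_L[OF g] L_closed by auto
    have period: "period (commutator g h) k =
        - poly_period a b (trace (pmat_deriv g ** commutator h k)) - period h (commutator g k)"
    proof -
      have "period (commutator g h) k + period h (commutator g k)
          = poly_period a b (- trace (pmat_deriv g ** commutator h k))"
        unfolding period_def trace_deriv_coadjoint[symmetric] J ..
      then show ?thesis by (simp add: J eq_diff_eq)
    qed
    have T: "wedge (mact (sl2_irrep 2 \<boxtimes> sl2_irrep 2) (?x, ?y) T) (jet1 a) (jet1 b) h k =
        - wedge T (jet1 a) (jet1 b) (commutator g h) k
            - wedge T (jet1 a) (jet1 b) h (commutator g k)"
      using supp unfolding wedge_def
      by (simp only: pairing_equivariant[OF xy jet_L_sl2(1)[OF L(1)] jet_L_sl2(1)[OF L(2)]]
          pairing_equivariant[OF xy jet_L_sl2(1)[OF L(2)] jet_L_sl2(1)[OF L(1)]]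
              jet_commutator_lift[OF L(1) jet] jet_commutator_lift[OF L(2) jet]) simp
    have u: "wedge (\<lambda>(i, j). mact (sl2_irrep 4 \<boxtimes> trivial_module) (?x, ?y) u (i
        + j, ())) (jet1 a) (jet2 a) h k =
        - wedge (\<lambda>(i, j). u (i + j, ())) (jet1 a) (jet2 a) (commutator g h) k
        - wedge (\<lambda>(i, j). u (i + j, ())) (jet1 a) (jet2 a) h (commutator g k)"
    proof -
      have act: "mact (sl2_irrep 4 \<boxtimes> trivial_module) (?x, ?y) u (i, ())
          = mact (sl2_irrep 4) ?x (\<lambda>i. u (i, ())) i" for i
        by (simp add: trivial_module_def)
      show ?thesis
        using supp unfolding wedge_def act
        by (simp add: quartic_pairing_equivariant[OF xy(1)] jet_L_sl2 L
            jet_commutator_lift[OF L(1) jet] jet_commutator_lift[OF L(2) jet])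
    qed
    have v: "wedge (\<lambda>(i, j). mact (trivial_module \<boxtimes> sl2_irrep 4) (?x, ?y) v ((), i
        + j)) (jet1 b) (jet2 b) h k =
        - wedge (\<lambda>(i, j). v ((), i + j)) (jet1 b) (jet2 b) (commutator g h) k
        - wedge (\<lambda>(i, j). v ((), i + j)) (jet1 b) (jet2 b) h (commutator g k)"
    proof -
      have act: "mact (trivial_module \<boxtimes> sl2_irrep 4) (?x, ?y) v ((), i)
          = mact (sl2_irrep 4) ?y (\<lambda>i. v ((), i)) i" for i
        by (simp add: trivial_module_def)
      show ?thesis
        using supp unfolding wedge_def act
        by (simp add: quartic_pairing_equivariant[OF xy(2)] jet_L_sl2 L
            jet_commutator_lift[OF L(1) jet] jet_commutator_lift[OF L(2) jet])
    qed
    have z: "mact (trivial_module \<boxtimes> trivial_module) (?x, ?y) z ((), ()) = 0"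
      by (simp add: trivial_module_def)
    show ?thesis
      unfolding P_eq target_ops cocycle_of.simps gl2t.coadjoint2_def gl2t.diff1_def \<eta>_def z T u v
      using L by (simp add: period algebra_simps)
  qed (auto simp: P_eq target_ops gl2t.coadjoint2_def gl2t.diff1_def)
  ultimately show ?thesis
    unfolding gl2t.coboundaries2_def by (auto simp: image_iff fun_eq_iff)
qed

section \<open>Components of cochains along the standard basis, with the factor \<open>f\<close>
  divided out\<close>

definition component :: "(pmat \<Rightarrow> pmat \<Rightarrow> complex) \<Rightarrow> cmat \<Rightarrow> cmat \<Rightarrow> complex poly \<Rightarrow> complex poly \<Rightarrow>
    complex" where
  "component \<omega> X Y u v = \<omega> (pure_tensor X (f * u)) (pure_tensor Y (f * v))"

lemma pure_tensor_L: "X \<in> sl2 \<Longrightarrow> pure_tensor X (f * u) \<in> L"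
  by (simp add: mem_L_iff pure_tensor_def mem_sl2_iff dvd_smult)

lemma pure_tensor_linear:
  "pure_tensor X (f * (u + v)) = pure_tensor X (f * u) + pure_tensor X (f * v)"
  "pure_tensor X (f * smult c u) = map_matrix (smult c) (pure_tensor X (f * u))"
  "pure_tensor (map_matrix ((*) c) X) p = map_matrix (smult c) (pure_tensor X p)"
  by (simp_all add: vec_eq_iff pure_tensor_def smult_add_right algebra_simps)

lemma component_bilinear:
  assumes "\<omega> \<in> gl2t.cochains2 L" "X \<in> sl2" "Y \<in> sl2"
  shows "bilinear_form (component \<omega> X Y)"
  using assms(1) pure_tensor_L[OF assms(2)] pure_tensor_L[OF assms(3)]
  unfolding bilinear_form_def component_def pure_tensor_linear gl2t.cochains2_def by auto

lemma component_skew: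
  assumes "\<omega> \<in> gl2t.cochains2 L" "X \<in> sl2" "Y \<in> sl2"
  shows "component \<omega> X Y u v = - component \<omega> Y X v u"
  unfolding component_def
  by (rule gl2t.cochains2_skew[OF assms(1) subspace_L]) (intro pure_tensor_L assms)+

lemma component_scale:
  assumes "\<omega> \<in> gl2t.cochains2 L" "X \<in> sl2" "Y \<in> sl2"
  shows "component \<omega> (map_matrix ((*) c) X) Y u v = c * component \<omega> X Y u v"
  using assms(1) pure_tensor_L[OF assms(2)] pure_tensor_L[OF assms(3)]
  unfolding component_def pure_tensor_linear gl2t.cochains2_def by auto

text \<open>A commutator of two pure tensors carries \<open>f\<close> twice; one factor belongs to
  \<open>component\<close> and the other stays in its argument, whence
  \<open>f * (u * v)\<close>.\<close>

lemma component_cocycle: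
  assumes \<omega>: "\<omega> \<in> gl2t.cocycles2 L" and "X \<in> sl2" "Y \<in> sl2" "Z \<in> sl2"
  shows "component \<omega> (commutator X Y) Z (f * (u * v)) w
      + component \<omega> (commutator Y Z) X (f * (v * w)) u
    + component \<omega> (commutator Z X) Y (f * (w * u)) v = 0"
proof -
  let ?x = "pure_tensor X (f * u)" and ?y = "pure_tensor Y (f * v)" and ?z = "pure_tensor Z (f * w)"
  have L: "?x \<in> L" "?y \<in> L" "?z \<in> L"
    by (intro pure_tensor_L assms)+
  have "gl2t.diff2 L \<omega> ?x ?y ?z = 0"
    using \<omega> by (simp add: gl2t.cocycles2_def)
  then have sum: "\<omega> (commutator ?x ?y) ?z - \<omega> (commutator ?x ?z) ?y + \<omega> (commutator ?y ?z) ?x = 0"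
    using L by (simp add: gl2t.diff2_def algebra_simps)
  have scale: "\<omega> (map_matrix (smult c) x) y = c * \<omega> x y" if "x \<in> L" "y \<in> L" for c x y
    using \<omega> that unfolding gl2t.cocycles2_def gl2t.cochains2_def by blast
  have "commutator ?x ?z = map_matrix (smult (- 1)) (commutator ?z ?x)"
    by (simp add: mat2_simps)
  moreover have "\<omega> (map_matrix (smult (- 1)) (commutator ?z ?x)) ?y = - \<omega> (commutator ?z ?x) ?y"
    using scale[OF L_closed[OF L(3,1)] L(2), of "- 1"] by simp
  ultimately have "\<omega> (commutator ?x ?y) ?z + \<omega> (commutator ?y ?z) ?x + \<omega> (commutator ?z ?x) ?y = 0"
    using sum by (simp add: algebra_simps)
  then show ?thesis
    by (simp add: component_def commutator_pure_tensor mult_ac)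
qed

definition E :: cmat where "E = (\<chi> i j. if i = 1 \<and> j = 2 then 1 else 0)"
definition F :: cmat where "F = (\<chi> i j. if i = 2 \<and> j = 1 then 1 else 0)"
definition H :: cmat where "H = (\<chi> i j. if i = 1 \<and> j = 1 then 1 else
    if i = 2 \<and> j = 2 then - 1 else 0)"

lemma sl2_basis [simp]: "E \<in> sl2" "F \<in> sl2" "H \<in> sl2"
  by (simp_all add: E_def F_def H_def mem_sl2_iff)

text \<open>Every bracket is a scaled basis matrix, even for the scalars 0 and 1, so that
  \<open>component_scale\<close> and \<open>\<eta>_tensor\<close> treat all cases alike.\<close>

lemma commutator_basis:
  "commutator E E = map_matrix ((*) 0) H" "commutator F F = map_matrix ((*) 0) H"
      "commutator H H = map_matrix ((*) 0) H"
  "commutator E F = map_matrix ((*) 1) H" "commutator F E = map_matrix ((*) (- 1)) H"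
  "commutator H E = map_matrix ((*) 2) E" "commutator E H = map_matrix ((*) (- 2)) E"
  "commutator H F = map_matrix ((*) (- 2)) F" "commutator F H = map_matrix ((*) 2) F"
  by (simp_all add: mat2_simps E_def F_def H_def)

text \<open>The three families of pure tensors span \<open>L\<close>, and skewness supplies the
  pairs of basis matrices that are not listed.\<close>

lemma cochain2_eq_0:
  assumes \<omega>: "\<omega> \<in> gl2t.cochains2 L"
    and "\<And>u v. component \<omega> E E u v = 0" "\<And>u v. component \<omega> E H u v = 0"
        "\<And>u v. component \<omega> E F u v = 0"
    "\<And>u v. component \<omega> H H u v = 0" "\<And>u v. component \<omega> F H u v = 0" "\<And>u v. component \<omega> F F u v = 0"
  shows "\<omega> = (\<lambda>g h. 0)"
proof (intro ext)
  fix g h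
  have comp: "component \<omega> X Y u v = 0" if "X \<in> {E, F, H}" "Y \<in> {E, F, H}" for X Y u v
    using that assms(2-) component_skew[OF \<omega>, of X Y u v] by auto
  have decomp: "\<exists>u v w. g = pure_tensor E (f * u) + (pure_tensor F (f * v) + pure_tensor H (f * w))"
      if g: "g \<in> L" for g
  proof -
    obtain u v w where "g $ 1 $ 2 = f * u" "g $ 2 $ 1 = f * v" "g $ 1 $ 1 = f * w"
      using g unfolding mem_L_iff dvd_def by metis
    then have "g = pure_tensor E (f * u) + (pure_tensor F (f * v) + pure_tensor H (f * w))"
      using g by (simp add: mem_L_iff vec_eq_iff forall_2 pure_tensor_def E_def F_def H_def)
    then show ?thesis by blast
  qed
  show "\<omega> g h = 0"
  proof (cases "g \<in> L \<and> h \<in> L")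
    case True
    have add: "\<omega> (x + y) z = \<omega> x z + \<omega> y z" "\<omega> z (x + y) = \<omega> z x + \<omega> z y"
      if "x \<in> L" "y \<in> L" "z \<in> L" for x y z
      using \<omega> that unfolding gl2t.cochains2_def by blast+
    obtain u v w u' v' w' where "g = pure_tensor E (f * u) + (pure_tensor F (f * v)
        + pure_tensor H (f * w))"
      "h = pure_tensor E (f * u') + (pure_tensor F (f * v') + pure_tensor H (f * w'))"
      using decomp True by metis
    then show ?thesis
      using comp[unfolded component_def]
      by (simp add: add pure_tensor_L gl2t.subspace_add[OF subspace_L])
  next
    case False
    then show ?thesis using \<omega> unfolding gl2t.cochains2_def by blast
  qed
qed

text \<open>The factors come from the derivatives \<open>a - b\<close> and \<open>b - a\<close> of
  \<open>f\<close> at its roots. Second jets also contribute a multiple of the value of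
  \<open>u\<close>, but these terms are symmetric and cancel in \<open>wedge\<close>.\<close>

lemma component_cocycle_of:
  assumes "X \<in> sl2" "Y \<in> sl2"
  shows "component (cocycle_of (z, T, p, q)) X Y u v = z ((), ()) * trace (X ** Y) * period_form u v
    - (a - b)\<^sup>2 * (pairing T X Y * (poly u a * poly v b) - pairing T Y X * (poly u b * poly v a))
    + 2 * (a - b)\<^sup>2 * (quartic_pairing (\<lambda>i. p (i, ())) X Y * jet_form a u v
        + quartic_pairing (\<lambda>i. q ((), i)) X Y * jet_form b u v)"
proof -
  let ?x = "pure_tensor X (f * u)" and ?y = "pure_tensor Y (f * v)"
  have jets: "jet1 a (pure_tensor X (f * u)) = map_matrix ((*) ((a - b) * poly u a)) X"
    "jet1 b (pure_tensor X (f * u)) = map_matrix ((*) ((b - a) * poly u b)) X"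
    "jet2 a (pure_tensor X (f * u)) = map_matrix ((*) (2 * (a - b) * poly (pderiv u) a
        + 2 * poly u a)) X"
    "jet2 b (pure_tensor X (f * u)) = map_matrix ((*) (2 * (b - a) * poly (pderiv u) b
        + 2 * poly u b)) X" for X u
    by (simp_all add: vec_eq_iff pure_tensor_def pderiv_smult pderiv_mult pderiv_add algebra_simps)
  have "trace (?x ** pmat_deriv ?y) = smult (trace (X ** Y)) (f * u * pderiv (f * v))"
    by (simp add: trace_def mat2_simps pure_tensor_def pderiv_smult smult_add_left mult_ac)
  then have "period ?x ?y = trace (X ** Y) * period_form u v"
    by (simp only: period_def period_form_def linear_formD[OF linear_form_poly_period])
  moreover note quartic_pairing_sym[of "\<lambda>i. p (i, ())" Y X] quartic_pairing_sym[of "\<lambda>i. q ((),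
      i)" Y X]
  ultimately show ?thesis
    using pure_tensor_L[OF assms(1)] pure_tensor_L[OF assms(2)]
    by (simp add: component_def wedge_def jets pairing_linear jet_form_def power2_eq_square)
      (simp add: algebra_simps)
qed

lemma pairing_basis:
  "pairing T E E = T (2, 2)" "pairing T E H = 2 * T (2, 1)" "pairing T H E = 2 * T (1, 2)"
  "pairing T E F = - T (2, 0)" "pairing T F E = - T (0, 2)" "pairing T H H = 4 * T (1, 1)"
  "pairing T H F = - 2 * T (1, 0)" "pairing T F H = - 2 * T (0, 1)" "pairing T F F = T (0, 0)"
  by (simp_all add: pairing_expand E_def F_def H_def)

lemma quartic_pairing_basis:
  "quartic_pairing u E E = u 4" "quartic_pairing u E H = 2 * u 3" "quartic_pairing u E F = - u 2"
  "quartic_pairing u H H = 4 * u 2" "quartic_pairing u F H = - 2 * u 1"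
      "quartic_pairing u F F = u 0"
  by (simp_all only: quartic_pairing_expand) (simp_all add: E_def F_def H_def)

lemma trace_basis:
  "trace (E ** E) = 0" "trace (E ** H) = 0" "trace (E ** F) = 1" "trace (H ** H) = 2"
  "trace (F ** H) = 0" "trace (F ** F) = 0"
  by (simp_all add: trace_def mat2_simps E_def F_def H_def)

section \<open>Classification of cocycles\<close>

lemma basis_nth:
  "E $ 1 $ 1 = 0" "E $ 1 $ 2 = 1" "E $ 2 $ 1 = 0" "F $ 1 $ 1 = 0" "F $ 1 $ 2 = 0" "F $ 2 $ 1 = 1"
  "H $ 1 $ 1 = 1" "H $ 1 $ 2 = 0" "H $ 2 $ 1 = 0"
  by (simp_all add: E_def F_def H_def)

text \<open>For \<open>X\<close> equal to \<open>E\<close> or \<open>F\<close>: the cocycle identity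
  at \<open>X, X, H\<close> gives the first claim and at \<open>X, H, H\<close> the second.\<close>

lemma component_weight_vector:
  assumes \<omega>: "\<omega> \<in> gl2t.cocycles2 L" and X: "X \<in> sl2" and s: "s \<noteq> 0"
    and XX: "commutator X X = map_matrix ((*) 0) H" and HX: "commutator H X = map_matrix ((*) s) X"
    and XH: "commutator X H = map_matrix ((*) (- s)) X"
  shows "component \<omega> X X (f * (u * v)) w = component \<omega> X X (f * (v * w)) u"
    "component \<omega> X H (f * (u * v)) w = component \<omega> X H (f * (v * w)) u"
proof -
  have \<omega>': "\<omega> \<in> gl2t.cochains2 L"
    using \<omega> by (simp add: gl2t.cocycles2_def)
  note scale = component_scale[OF \<omega>']
  have "s * component \<omega> X X (f * (u * v)) w = s * component \<omega> X X (f * (v * w)) u"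
    using component_cocycle[OF \<omega> X X sl2_basis(3), of u w v]
    by (simp only: XX HX XH scale X sl2_basis) (simp add: mult.commute)
  then show "component \<omega> X X (f * (u * v)) w = component \<omega> X X (f * (v * w)) u"
    using s by simp
  have "s * component \<omega> X H (f * (u * v)) w = s * component \<omega> X H (f * (v * w)) u"
    using component_cocycle[OF \<omega> X sl2_basis(3) sl2_basis(3), of v u w]
    by (simp only: commutator_basis HX XH scale X sl2_basis) (auto simp add: mult.commute)
  then show "component \<omega> X H (f * (u * v)) w = component \<omega> X H (f * (v * w)) u"
    using s by simp
qed

text \<open>The cocycle identity at \<open>X, X, Y\<close>, with \<open>Y\<close> of opposite
  weight. It provides the condition on the second argument that \<open>mixed_form\<close>
  requires.\<close>

lemma component_weight_vector_opposite:
  assumes \<omega>: "\<omega> \<in> gl2t.cocycles2 L" and X: "X \<in> sl2" and Y: "Y \<in> sl2" and r: "r \<noteq> 0"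
    and XX: "commutator X X = map_matrix ((*) 0) H" and XY: "commutator X Y = map_matrix ((*) r) H"
    and YX: "commutator Y X = map_matrix ((*) (- r)) H"
  shows "component \<omega> X H w (f * (u * v)) = component \<omega> X H u (f * (v * w))"
proof -
  have \<omega>': "\<omega> \<in> gl2t.cochains2 L"
    using \<omega> by (simp add: gl2t.cocycles2_def)
  have "r * component \<omega> H X (f * (u * v)) w = r * component \<omega> H X (f * (v * w)) u"
    using component_cocycle[OF \<omega> X X Y, of w u v]
    by (simp only: XX XY YX component_scale[OF \<omega>'] X Y sl2_basis) auto
  then show ?thesis
    using r component_skew[OF \<omega>' X sl2_basis(3)] by simp
qed

text \<open>The value depends on \<open>u\<close> and \<open>v\<close> only through their product.
  Hence functionals of \<open>u * v\<close> can be removed by coboundaries, and anything else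
  obstructs exactness.\<close>

lemma component_coboundary:
  assumes "\<eta> \<in> gl2t.cochains1 L" "X \<in> sl2" "Y \<in> sl2"
  shows "component (gl2t.diff1 L \<eta>) X Y u v = - \<eta> (pure_tensor (commutator X Y) (f * f * (u * v)))"
  using pure_tensor_L[OF assms(2)] pure_tensor_L[OF assms(3)]
  by (simp add: component_def gl2t.diff1_def commutator_pure_tensor mult_ac)

text \<open>Surjectivity: the classified components are matched with those of an explicit cocycle
  plus a coboundary.\<close>

lemma cocycle_representative:
  assumes \<omega>: "\<omega> \<in> gl2t.cocycles2 L"
  obtains P where "P \<in> mcarrier target_module"
      "(\<lambda>g h. \<omega> g h - cocycle_of P g h) \<in> gl2t.coboundaries2 L"
proof -
  have \<omega>': "\<omega> \<in> gl2t.cochains2 L"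
    using \<omega> by (simp add: gl2t.cocycles2_def)
  note bil = component_bilinear[OF \<omega>'] and skew = component_skew[OF \<omega>']
      and scale = component_scale[OF \<omega>']
  let ?c = "component \<omega>"
  have E: "?c E E (f * (u * v)) w = ?c E E (f * (v * w)) u"
      "?c E H (f * (u * v)) w = ?c E H (f * (v * w)) u"
    "?c E H w (f * (u * v)) = ?c E H u (f * (v * w))" for u v w
    by (rule component_weight_vector[OF \<omega>, of _ 2] component_weight_vector_opposite[OF \<omega>, of _ F 1];
        simp add: commutator_basis)+
  have F: "?c F F (f * (u * v)) w = ?c F F (f * (v * w)) u"
      "?c F H (f * (u * v)) w = ?c F H (f * (v * w)) u"
    "?c F H w (f * (u * v)) = ?c F H u (f * (v * w))" for u v w
    by (rule component_weight_vector[OF \<omega>, of _ "- 2"] component_weight_vector_opposite[OF \<omega>,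
        of _ E "- 1"];
        simp add: commutator_basis)+
  have H: "?c H H (f * (u * v)) w - 2 * ?c E F u (f * (v * w)) + 2 * ?c E F (f * (w * u)) v = 0"
      for u v w
    using component_cocycle[OF \<omega> sl2_basis, of u v w] skew[OF sl2_basis(1,2), of u "f * (v * w)"]
    by (simp only: commutator_basis scale sl2_basis) simp
  obtain x1 y1 z1 where EE: "\<And>u v. ?c E E u v = x1 * jet_form a u v + y1 * jet_form b u v
      + z1 * cross_form u v"
    using skew_form_totally_symmetric_on_f[OF bil[OF sl2_basis(1,1)] skew[OF sl2_basis(1,1)] E(1)]
        by blast
  obtain x2 y2 z2 where FF: "\<And>u v. ?c F F u v = x2 * jet_form a u v + y2 * jet_form b u v
      + z2 * cross_form u v"
    using skew_form_totally_symmetric_on_f[OF bil[OF sl2_basis(2,2)] skew[OF sl2_basis(2,2)] F(1)]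
        by blast
  obtain \<phi>E x3 y3 z3 w3 where \<phi>E: "linear_form \<phi>E"
      and EH: "\<And>u v. ?c E H u v = \<phi>E (u * v) + x3 * jet_form a u v
      + y3 * jet_form b u v + z3 * (poly u a * poly v b) + w3 * (poly u b * poly v a)"
    using mixed_form[OF bil[OF sl2_basis(1,3)] E(2,3)] by blast
  obtain \<phi>F x4 y4 z4 w4 where \<phi>F: "linear_form \<phi>F"
      and FH: "\<And>u v. ?c F H u v = \<phi>F (u * v) + x4 * jet_form a u v
      + y4 * jet_form b u v + z4 * (poly u a * poly v b) + w4 * (poly u b * poly v a)"
    using mixed_form[OF bil[OF sl2_basis(2,3)] F(2,3)] by blast
  obtain \<phi>H \<mu> x5 y5 z5 w5 s where \<phi>H: "linear_form \<phi>H"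
    and EF: "\<And>u v. ?c E F u v = \<phi>H (u * v) + \<mu> * period_form u v - x5 * jet_form a u v
        - y5 * jet_form b u v
      + z5 * (poly u a * poly v b) + w5 * (poly u b * poly v a)"
    and HH: "\<And>u v. ?c H H u v = 2 * \<mu> * period_form u v + 4 * x5 * jet_form a u v
        + 4 * y5 * jet_form b u v
      + s * cross_form u v"
    using weight_zero_forms[OF bil[OF sl2_basis(1,2)] bil[OF sl2_basis(3,3)]
        skew[OF sl2_basis(3,3)] H] by blast
  define \<delta> where "\<delta> = (a - b)\<^sup>2"
  have \<delta>: "\<delta> \<noteq> 0"
    using neq by (simp add: \<delta>_def)
  \<comment> \<open>The entries solve \<open>component_cocycle_of\<close> for the six components. In
    \<open>T\<close> the indices 0, 1, 2 belong to \<open>F\<close>, \<open>H\<close>,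
    \<open>E\<close>.\<close>
  define P :: params where "P = (\<lambda>_. \<mu>,
    (\<lambda>_. 0)((0, 0) := - z2 / \<delta>, (0, 1) := z4 / (2 * \<delta>), (0, 2) := - w5 / \<delta>, (1, 0) :=
        - w4 / (2 * \<delta>),
      (1, 1) := - s / (4 * \<delta>), (1, 2) := w3 / (2 * \<delta>), (2, 0) := z5 / \<delta>, (2, 1) := - z3 / (2 * \<delta>),
          (2, 2) := - z1 / \<delta>),
    (\<lambda>_. 0)((0, ()) := x2 / (2 * \<delta>), (1, ()) := - x4 / (4 * \<delta>), (2, ()) := x5 / (2 * \<delta>), (3,
        ()) := x3 / (4 * \<delta>),
      (4, ()) := x1 / (2 * \<delta>)),
    (\<lambda>_. 0)(((), 0) := y2 / (2 * \<delta>), ((), 1) := - y4 / (4 * \<delta>), ((), 2) := y5 / (2 * \<delta>), ((),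
        3) := y3 / (4 * \<delta>),
      ((), 4) := y1 / (2 * \<delta>)))"
  \<comment> \<open>Commutators of pure tensors carry \<open>f * f\<close>, so the division returns
    \<open>u * v\<close>; on other elements of \<open>L\<close> linearity of \<open>div\<close>
    suffices. The halves and signs undo the structure constants of \<open>[E, H]\<close>,
    \<open>[F, H]\<close> and \<open>[E, F]\<close>.\<close>
  define \<eta> where "\<eta> g = (if g \<in> L then 1/2 * \<phi>E (g $ 1 $ 2 div (f * f))
      - 1/2 * \<phi>F (g $ 2 $ 1 div (f * f))
    - \<phi>H (g $ 1 $ 1 div (f * f)) else 0)" for g
  have \<eta>: "\<eta> \<in> gl2t.cochains1 L"
    unfolding gl2t.cochains1_def \<eta>_def
    by (auto simp: gl2t.subspace_add[OF subspace_L] gl2t.subspace_scale[OF subspace_L]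
        poly_div_add_left
        div_smult_left linear_formD[OF \<phi>E] linear_formD[OF \<phi>F] linear_formD[OF \<phi>H] algebra_simps)
  have \<eta>_tensor: "\<eta> (pure_tensor (map_matrix ((*) c) X) (f * f * u)) = c * (1/2 * X $ 1 $ 2 * \<phi>E u
      - 1/2 * X $ 2 $ 1 * \<phi>F u - X $ 1 $ 1 * \<phi>H u)" if "X \<in> sl2" for X u c
  proof -
    have "pure_tensor (map_matrix ((*) c) X) (f * f * u) \<in> L"
      using pure_tensor_L[of "map_matrix ((*) c) X"
          "f * u"] that by (simp add: mem_sl2_iff mult.assoc)
    moreover have "smult d (f * f * u) div (f * f) = smult d u" for d
      using f_neq_0 by (simp add: div_smult_left)
    ultimately show ?thesis
      by (simp add: \<eta>_def pure_tensor_def linear_formD[OF \<phi>E] linear_formD[OF \<phi>F]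
          linear_formD[OF \<phi>H] algebra_simps)
  qed
  define \<zeta> where "\<zeta> g h = 1 * \<omega> g h + (- 1) * (1 * cocycle_of P g h + 1 * gl2t.diff1 L \<eta> g h)"
      for g h
  have "gl2t.diff1 L \<eta> \<in> gl2t.coboundaries2 L"
    using \<eta> by (auto simp: gl2t.coboundaries2_def)
  then have "gl2t.diff1 L \<eta> \<in> gl2t.cochains2 L"
    using gl2t.coboundaries2_subset_cocycles2[OF subspace_L L_closed]
        by (auto simp: gl2t.cocycles2_def)
  then have \<zeta>: "\<zeta> \<in> gl2t.cochains2 L"
    unfolding \<zeta>_def by (intro gl2t.cochains2_lincomb \<omega>' cocycle_of_cochains2)
  have comp: "component \<zeta> X Y u v = ?c X Y u v - component (cocycle_of P) X Y u v
      - component (gl2t.diff1 L \<eta>) X Y u v" for X Y u v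
    by (simp add: component_def \<zeta>_def)
  note expand = comp component_coboundary[OF \<eta>] commutator_basis \<eta>_tensor P_def component_cocycle_of
    pairing_basis quartic_pairing_basis trace_basis \<delta>_def[symmetric]
  have "component \<zeta> E E u v = 0" "component \<zeta> F F u v = 0" for u v
    using \<delta> by (simp_all only: expand sl2_basis) (simp_all add: EE FF cross_form_def field_simps)
  moreover have "component \<zeta> E H u v = 0" for u v
    using \<delta> by (simp only: expand sl2_basis) (simp add: EH basis_nth field_simps)
  moreover have "component \<zeta> F H u v = 0" for u v
    using \<delta> by (simp only: expand sl2_basis) (simp add: FH basis_nth field_simps)
  moreover have "component \<zeta> E F u v = 0" for u v
    using \<delta> by (simp only: expand sl2_basis) (simp add: EF basis_nth field_simps)
  moreover have "component \<zeta> H H u v = 0" for u v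
    using \<delta> by (simp only: expand sl2_basis) (simp add: HH cross_form_def field_simps)
  ultimately have "\<zeta> = (\<lambda>g h. 0)"
    by (intro cochain2_eq_0[OF \<zeta>])
  then have "(\<lambda>g h. \<omega> g h - cocycle_of P g h) = gl2t.diff1 L \<eta>"
    by (simp add: \<zeta>_def fun_eq_iff algebra_simps)
  moreover have "P \<in> mcarrier target_module"
    by (simp add: P_def target_carrier)
  ultimately show ?thesis
    using that \<eta> unfolding gl2t.coboundaries2_def by blast
qed

text \<open>A coboundary takes equal values on different factorizations of one polynomial. Comparing
  suitable factorizations isolates each coefficient; the condition on \<open>z\<close> removes the
  period.\<close>

lemma cocycle_of_coefficients_eq_0:
  assumes cob: "cocycle_of (z, T, p, q) \<in> gl2t.coboundaries2 L" and X: "X \<in> sl2" and Y: "Y \<in> sl2"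
    and z: "z ((), ()) * trace (X ** Y) = 0"
  shows "quartic_pairing (\<lambda>i. p (i, ())) X Y = 0" "quartic_pairing (\<lambda>i. q ((), i)) X Y = 0"
    "pairing T X Y = 0" "pairing T Y X = 0"
proof -
  define A B where "A = [:- a, 1:]" and "B = [:- b, 1:]"
  have [simp]: "poly A a = 0" "poly B b = 0" "poly A b = b - a" "poly B a = a - b" "pderiv A = 1"
      "pderiv B = 1"
    by (simp_all add: A_def B_def pderiv_pCons one_pCons)
  have f: "f = A * B"
    by (simp only: f_def A_def B_def)
  obtain \<eta> where \<eta>: "\<eta> \<in> gl2t.cochains1 L" "cocycle_of (z, T, p, q) = gl2t.diff1 L \<eta>"
    using cob by (auto simp: gl2t.coboundaries2_def)
  define c where "c u v = component (cocycle_of (z, T, p, q)) X Y u v" for u v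
  have c_eq: "c u v = c u' v'" if "u * v = u' * v'" for u v u' v'
    unfolding c_def \<eta>(2) component_coboundary[OF \<eta>(1) X Y] that ..
  have c: "c u v = - (a - b)\<^sup>2 * (pairing T X Y * (poly u a * poly v b)
      - pairing T Y X * (poly u b * poly v a))
    + 2 * (a - b)\<^sup>2 * (quartic_pairing (\<lambda>i. p (i, ())) X Y * jet_form a u v
        + quartic_pairing (\<lambda>i. q ((), i)) X Y * jet_form b u v)" for u v
    unfolding c_def component_cocycle_of[OF X Y] z by simp
  \<comment> \<open>These products vanish at both points, each with nonzero derivative at exactly
    one of them, so a single jet form survives and changes sign under the swap.\<close>
  have "c 1 (A * B * B) = c (A * B * B) 1" "c 1 (A * A * B) = c (A * A * B) 1"
    by (intro c_eq; simp)+
  then show quartic: "quartic_pairing (\<lambda>i. p (i, ())) X Y = 0"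
      "quartic_pairing (\<lambda>i. q ((), i)) X Y = 0"
    using neq by (simp_all add: c jet_form_def pderiv_mult eq_neg_iff_add_eq_0)
  \<comment> \<open>With the jets gone, \<open>c f 1\<close> is zero, and each left side retains one
    of the two cross terms.\<close>
  have "c A B = c f 1" "c B A = c f 1"
    by (intro c_eq; simp add: f mult.commute)+
  then show "pairing T X Y = 0" "pairing T Y X = 0"
    using neq by (simp_all only: c quartic) simp_all
qed

lemma cocycle_of_coboundary_imp_0:
  assumes cob: "cocycle_of (z, T, p, q) \<in> gl2t.coboundaries2 L"
      and carrier: "(z, T, p, q) \<in> mcarrier target_module"
  shows "z = (\<lambda>_. 0)" "T = (\<lambda>_. 0)" "p = (\<lambda>_. 0)" "q = (\<lambda>_. 0)"
proof -
  let ?t = "[:0, 1:]"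
  obtain \<eta> where \<eta>: "\<eta> \<in> gl2t.cochains1 L" "cocycle_of (z, T, p, q) = gl2t.diff1 L \<eta>"
    using cob by (auto simp: gl2t.coboundaries2_def)
  define c where "c X Y u v = component (cocycle_of (z, T, p, q)) X Y u v" for X Y u v
  have sym: "c X Y u v = c X Y v u" if "X \<in> sl2" "Y \<in> sl2" for X Y u v
    unfolding c_def \<eta>(2) component_coboundary[OF \<eta>(1) that] by (simp only: mult.commute)
  \<comment> \<open>The weights 4 and 1 cancel the quartic coefficient \<open>- u 2\<close> of
    \<open>E F\<close> against \<open>4 * u 2\<close> of \<open>H H\<close>. The traces add up to 6,
    doubled by skewness of the period; the cross terms vanish with \<open>f * ?t\<close>.\<close>
  have "12 * z ((), ()) * period_form (f * ?t) 1 = 4 * (c E F (f * ?t) 1 - c E F 1 (f * ?t))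
      + (c H H (f * ?t) 1 - c H H 1 (f * ?t))"
    using period_form_skew[of 1 "f * ?t"]
    by (simp only: c_def component_cocycle_of sl2_basis
        pairing_basis quartic_pairing_basis trace_basis)
      (simp add: jet_form_def algebra_simps)
  then have "12 * z ((), ()) * period_form (f * ?t) 1 = 0"
    using sym[of E F "f * ?t" 1] sym[of H H "f * ?t" 1] by simp
  then have z: "z ((), ()) = 0"
    using period_form_f_t_1 by simp
  then show "z = (\<lambda>_. 0)"
    by (simp add: fun_eq_iff)
  note coeff = cocycle_of_coefficients_eq_0[OF cob]
  have zt: "z ((), ()) * t = 0" for t
    by (simp add: z)
  have low: "p (0, ()) = 0" "p (1, ()) = 0" "p (2, ()) = 0" "p (3, ()) = 0" "p (4, ()) = 0"
    "q ((), 0) = 0" "q ((), 1) = 0" "q ((), 2) = 0" "q ((), 3) = 0" "q ((), 4) = 0"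
    using coeff(1)[OF sl2_basis(2,2) zt] coeff(1)[OF sl2_basis(2,3) zt]
        coeff(1)[OF sl2_basis(1,2) zt] coeff(1)[OF sl2_basis(1,3) zt] coeff(1)[OF sl2_basis(1,1) zt]
      coeff(2)[OF sl2_basis(2,2) zt] coeff(2)[OF sl2_basis(2,3) zt] coeff(2)[OF sl2_basis(1,2) zt]
          coeff(2)[OF sl2_basis(1,3) zt] coeff(2)[OF sl2_basis(1,1) zt]
    by (simp_all add: pairing_basis numeral_2_eq_2[symmetric])
  have low_T: "T (0, 0) = 0" "T (0, 1) = 0" "T (0, 2) = 0" "T (1, 0) = 0" "T (1, 1) = 0"
      "T (1, 2) = 0"
    "T (2, 0) = 0" "T (2, 1) = 0" "T (2, 2) = 0"
    using coeff(3)[OF sl2_basis(1,1) zt] coeff(3)[OF sl2_basis(1,2) zt]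
        coeff(3)[OF sl2_basis(1,3) zt]
      coeff(3)[OF sl2_basis(2,1) zt] coeff(3)[OF sl2_basis(2,2) zt] coeff(3)[OF sl2_basis(2,3) zt]
      coeff(3)[OF sl2_basis(3,1) zt] coeff(3)[OF sl2_basis(3,2) zt] coeff(3)[OF sl2_basis(3,3) zt]
    by (simp_all add: pairing_basis)
  have "i = 0 \<or> i = 1 \<or> i = 2 \<or> i = 3 \<or> i = 4 \<or> i > 4" for i :: nat
    by arith
  then have "p (i, ()) = 0" "q ((), i) = 0" for i
    using low carrier unfolding target_carrier by metis+
  then show "p = (\<lambda>_. 0)" "q = (\<lambda>_. 0)"
    by (simp_all add: fun_eq_iff)
  have "i = 0 \<or> i = 1 \<or> i = 2 \<or> i > 2" for i :: nat
    by arith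
  then have "T (i, j) = 0" for i j
    using low_T carrier unfolding target_carrier by metis
  then show "T = (\<lambda>_. 0)"
    by (simp add: fun_eq_iff)
qed

section \<open>The isomorphism\<close>

abbreviation eval_ab :: "pmat \<Rightarrow> cmat \<times> cmat" where
  "eval_ab g \<equiv> (eval_at a g, eval_at b g)"

abbreviation cohomology :: "(cmat \<times> cmat, (pmat \<Rightarrow> pmat \<Rightarrow> complex) set) lie_mod" where
  "cohomology \<equiv> factored_module eval_ab (sl2_tensor UNIV) (gl2t.H2 L)"

definition class_of :: "params \<Rightarrow> (pmat \<Rightarrow> pmat \<Rightarrow> complex) set" where
  "class_of P = gl2t.cohomologous L `` {cocycle_of P}"

lemma class_eq_iff:
  assumes "\<omega> \<in> gl2t.cocycles2 L" "\<theta> \<in> gl2t.cocycles2 L"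
  shows "gl2t.cohomologous L `` {\<omega>} = gl2t.cohomologous L `` {\<theta>} \<longleftrightarrow>
    (\<lambda>g h. \<omega> g h - \<theta> g h) \<in> gl2t.coboundaries2 L"
  using eq_equiv_class_iff[OF gl2t.equiv_cohomologous assms] assms
      by (simp add: gl2t.cohomologous_iff)

lemma bij_class_of: "bij_betw class_of (mcarrier target_module) (mcarrier cohomology)"
  unfolding bij_betw_def
proof
  show "inj_on class_of (mcarrier target_module)"
  proof (rule inj_onI)
    fix P P' assume P: "P \<in> mcarrier target_module"
        "P' \<in> mcarrier target_module" and eq: "class_of P = class_of P'"
    obtain z T p q z' T' p' q' where P_eq: "P = (z, T, p, q)" "P' = (z', T', p', q')"
      by (metis prod_cases4)
    have "(\<lambda>g h. cocycle_of P g h - cocycle_of P' g h) \<in> gl2t.coboundaries2 L"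
      using eq unfolding class_of_def class_eq_iff[OF cocycle_of_cocycles2 cocycle_of_cocycles2] .
    moreover have "cocycle_of P g h - cocycle_of P' g h =
        cocycle_of (\<lambda>i. z i - z' i, \<lambda>i. T i - T' i, \<lambda>i. p i - p' i, \<lambda>i. q i - q' i) g h" for g h
      using cocycle_of_lincomb[of 1 z "- 1" z' T T' p p' q q' g h]
          by (simp add: P_eq del: cocycle_of.simps)
    ultimately have cob: "cocycle_of (\<lambda>i. z i - z' i, \<lambda>i. T i - T' i, \<lambda>i. p i - p' i, \<lambda>i. q i
        - q' i) \<in> gl2t.coboundaries2 L"
      by (simp del: cocycle_of.simps)
    have "(\<lambda>i. z i - z' i, \<lambda>i. T i - T' i, \<lambda>i. p i - p' i, \<lambda>i. q i - q' i) \<in> mcarrier target_module"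
      using P unfolding P_eq target_carrier by simp
    from cocycle_of_coboundary_imp_0[OF cob this] show "P = P'"
      by (simp add: P_eq fun_eq_iff)
  qed
  have "mcarrier cohomology = gl2t.cocycles2 L // gl2t.cohomologous L"
    by (simp add: factored_module_def gl2t.H2_carrier)
  moreover have "class_of ` mcarrier target_module = gl2t.cocycles2 L // gl2t.cohomologous L"
  proof (intro subset_antisym subsetI)
    fix A assume "A \<in> class_of ` mcarrier target_module"
    then show "A \<in> gl2t.cocycles2 L // gl2t.cohomologous L"
      by (auto simp: class_of_def intro: quotientI cocycle_of_cocycles2)
  next
    fix A assume "A \<in> gl2t.cocycles2 L // gl2t.cohomologous L"
    then obtain \<omega> where \<omega>: "\<omega> \<in> gl2t.cocycles2 L" and A: "A = gl2t.cohomologous L `` {\<omega>}"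
      by (elim quotientE)
    obtain P where P: "P \<in> mcarrier target_module"
        "(\<lambda>g h. \<omega> g h - cocycle_of P g h) \<in> gl2t.coboundaries2 L"
      using cocycle_representative[OF \<omega>] .
    then have "A = class_of P"
      unfolding A class_of_def class_eq_iff[OF \<omega> cocycle_of_cocycles2] by simp
    then show "A \<in> class_of ` mcarrier target_module"
      using P(1) by blast
  qed
  ultimately show "class_of ` mcarrier target_module = mcarrier cohomology"
    by simp
qed

lemma class_of_madd: "madd cohomology (class_of P) (class_of P')
    = class_of (madd target_module P P')"
proof -
  obtain z T p q z' T' p' q' where P_eq: "P = (z, T, p, q)" "P' = (z', T', p', q')"
    by (metis prod_cases4)
  have "cocycle_of (madd target_module P P') = (\<lambda>g h. cocycle_of P g h + cocycle_of P' g h)"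
    using cocycle_of_lincomb[of 1 z 1 z' T T' p p' q q']
    unfolding P_eq target_ops by (simp add: fun_eq_iff del: cocycle_of.simps)
  then show ?thesis
    by (simp add: factored_module_def class_of_def gl2t.H2_madd_class cocycle_of_cocycles2)
qed

lemma class_of_mscale: "mscale cohomology c (class_of P) = class_of (mscale target_module c P)"
proof -
  obtain z T p q where P_eq: "P = (z, T, p, q)"
    by (metis prod_cases4)
  have "cocycle_of (mscale target_module c P) = (\<lambda>g h. c * cocycle_of P g h)"
    using cocycle_of_lincomb[of c z 0 z T T p p q q]
    unfolding P_eq target_ops by (simp add: fun_eq_iff del: cocycle_of.simps)
  then show ?thesis
    by (simp add: factored_module_def class_of_def gl2t.H2_mscale_class cocycle_of_cocycles2)
qed

lemma class_of_mact:
  assumes "xy \<in> sl2 \<times> sl2" "P \<in> mcarrier target_module"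
  shows "mact cohomology xy (class_of P) = class_of (mact target_module xy P)"
proof -
  obtain x y where xy: "xy = (x, y)" "x \<in> sl2" "y \<in> sl2"
    using assms(1) by blast
  obtain g where g: "g \<in> sl2_tensor UNIV" "eval_at a g = x" "eval_at b g = y" "jet1 a g = 0"
      "jet1 b g = 0"
    using sl2_sl2_lift[OF neq xy(2,3)] .
  \<comment> \<open>All lifts act alike, so \<open>the_elem\<close> may be computed with the
    interpolating lift \<open>g\<close>, for which \<open>coadjoint2_cocycle_of\<close>
    applies.\<close>
  have act: "mact (gl2t.H2 L) h (class_of P) = mact (gl2t.H2 L) g (class_of P)"
    if "h \<in> sl2_tensor UNIV" "eval_ab h = xy" for h
    unfolding class_of_def
    using that g xy
    by (intro gl2t.H2_mact_class_cong subspace_L L_closed bracket_L kernel_eval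
        cocycle_of_cocycles2) auto
  have "(\<lambda>h. mact (gl2t.H2 L) h (class_of P)) ` {h \<in> sl2_tensor UNIV. eval_ab h = xy}
      = {mact (gl2t.H2 L) g (class_of P)}"
    using act g xy by blast
  then have "mact cohomology xy (class_of P) = mact (gl2t.H2 L) g (class_of P)"
    by (simp add: factored_module_def)
  also have "\<dots> = gl2t.cohomologous L `` {gl2t.coadjoint2 L g (cocycle_of P)}"
    unfolding class_of_def by (intro gl2t.H2_mact_class subspace_L L_closed bracket_L g(1)
        cocycle_of_cocycles2)
  also have "\<dots> = class_of (mact target_module xy P)"
    unfolding class_of_def
    using coadjoint2_cocycle_of[OF assms(2) g(1,4,5)]
      gl2t.coadjoint2_cocycles2[OF subspace_L L_closed bracket_L[OF g(1)] cocycle_of_cocycles2]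
    by (subst class_eq_iff[OF _ cocycle_of_cocycles2]) (simp_all only: g(2,3) xy(1))
  finally show ?thesis .
qed

lemma isomorphic_cohomology_target: "gl2_gl2.isomorphic_modules (sl2 \<times> sl2) cohomology
    target_module"
proof (rule gl2_gl2.isomorphic_modules_transport[OF lie_module_target bij_class_of])
qed (auto simp: class_of_madd class_of_mscale class_of_mact mem_sl2_iff mat2_simps algebra_simps)

end

theorem theorem7p1p1:
  fixes a b :: complex and f :: "complex poly" and I :: "complex poly set"
  assumes "a \<noteq> b"
    and "f = [:- a, 1:] * [:- b, 1:]"
    and "I = {p. f dvd p}"
  shows "gl2_gl2.isomorphic_modules (sl2 \<times> sl2)
    (factored_module (\<lambda>g. (eval_at a g, eval_at b g)) (sl2_tensor UNIV) (gl2t.H2 (sl2_tensor I)))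
    (trivial_module \<boxtimes> trivial_module \<oplus>\<^sub>m sl2_irrep 2 \<boxtimes> sl2_irrep 2 \<oplus>\<^sub>m
     sl2_irrep 4 \<boxtimes> trivial_module \<oplus>\<^sub>m trivial_module \<boxtimes> sl2_irrep 4)"
proof -
  interpret two_points a b
    by unfold_locales (rule assms(1))
  have "sl2_tensor I = two_points.L a b"
    by (simp add: assms L_def f_def)
  then show ?thesis
    using isomorphic_cohomology_target by simp
qed

end
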